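(* Let $G$ be a connected graph of order $n\ge 2$ and let $\mathcal{H}=\{P_{q_1},\ldots,P_{q_r},C_{q_{r+1}},\ldots,C_{q_n}\}$, where $q_i\ge 4$ for $1\le i\le r$ and $q_i\ge 5$ for $r+1\le i\le n$. Then (i) $\dim_2(G\circ\mathcal{H})=\sum_{i=1}^r\lceil\frac{q_i+1}{2}\rceil+\sum_{i=r+1}^n\lceil\frac{q_i}{2}\rceil$; (ii) $\dim_3(G\circ\mathcal{H})=\sum_{i=1}^r\left(q_i-\lfloor\frac{q_i-4}{5}\rfloor\right)+\sum_{i=r+1}^n\left(q_i-\lfloor\frac{q_i}{5}\rfloor\right)$. Moreover, if $\mathcal{H}=\{C_{q_1},\ldots,C_{q_n}\}$ with all $q_i\ge 5$, then $\dim_4(G\circ\mathcal{H})=\sum_{i=1}^n q_i$.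
   Context: $P_q$ and $C_q$ are the path and cycle of order $q$. With $V(G)=\{u_1,\ldots,u_n\}$ and $\mathcal{H}=\{H_1,\ldots,H_n\}$ (listed in the given order, $H_i$ attached to $u_i$), the lexicographic product $G\circ\mathcal{H}$ has vertex set $\bigcup_i\{u_i\}\times V(H_i)$, with $(u_i,v)\sim(u_j,w)$ iff $u_iu_j\in E(G)$, or $i=j$ and $vw\in E(H_i)$. For a connected graph $X$, $\dim_k(X)$ is the minimum size of $S\subseteq V(X)$ such that every two distinct vertices $x,y$ admit at least $k$ vertices $w\in S$ with $d_X(x,w)\neq d_X(y,w)$. *)

theory Defs
  imports "Graph_Theory.Graph_Theory"
begin

text \<open>Simple graphs are the symmetric loop-free pair digraphs (locale \<^locale>\<open>pair_graph\<close>)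
  of the AFP entry on graph theory.\<close>

definition path_graph :: "nat \<Rightarrow> nat pair_pre_digraph" where
  "path_graph q = \<lparr> pverts = {..<q},
     parcs = {(v, w). v < q \<and> w < q \<and> (w = Suc v \<or> v = Suc w)} \<rparr>"

text \<open>A cycle only for \<open>q \<ge> 3\<close>: degenerate (with a loop for \<open>q = 1\<close>) below that.\<close>

definition cycle_graph :: "nat \<Rightarrow> nat pair_pre_digraph" where
  "cycle_graph q = \<lparr> pverts = {..<q},
     parcs = {(v, w). v < q \<and> w < q \<and> (w = Suc v mod q \<or> v = Suc w mod q)} \<rparr>"

text \<open>Here \<open>u 1, \<dots>, u n\<close> is meant to enumerate the vertices of \<open>G\<close> without repetition.\<close>

definition lex_product ::
  "'a pair_pre_digraph \<Rightarrow> nat \<Rightarrow> (nat \<Rightarrow> 'a) \<Rightarrow> (nat \<Rightarrow> 'b pair_pre_digraph)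
     \<Rightarrow> ('a \<times> 'b) pair_pre_digraph" where
  "lex_product G n u H = \<lparr>
     pverts = (\<Union>i\<in>{1..n}. {u i} \<times> pverts (H i)),
     parcs = {((u i, v), (u j, w)) | i j v w.
        i \<in> {1..n} \<and> j \<in> {1..n} \<and> v \<in> pverts (H i) \<and> w \<in> pverts (H j) \<and>
        ((u i, u j) \<in> parcs G \<or> i = j \<and> (v, w) \<in> parcs (H i))} \<rparr>"

text \<open>The graph distance is the cost of a cheapest walk when every arc has weight 1.\<close>

definition graph_dist :: "'a pair_pre_digraph \<Rightarrow> 'a \<Rightarrow> 'a \<Rightarrow> ereal" where
  "graph_dist X v w = wf_digraph.\<mu> (with_proj X) (\<lambda>_. 1) v w"

definition k_metric_generator :: "nat \<Rightarrow> 'a pair_pre_digraph \<Rightarrow> 'a set \<Rightarrow> bool" where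
  "k_metric_generator k X S \<longleftrightarrow> S \<subseteq> pverts X \<and>
     (\<forall>x\<in>pverts X. \<forall>y\<in>pverts X. x \<noteq> y \<longrightarrow>
        k \<le> card {w \<in> S. graph_dist X x w \<noteq> graph_dist X y w})"

text \<open>For finite \<open>X\<close>. If there is no \<open>k\<close>-metric generator, the value is 0 (the infimum
  of the empty set of naturals), so a positive value entails that a generator exists
  and that the minimum is attained.\<close>

definition metric_dim :: "nat \<Rightarrow> 'a pair_pre_digraph \<Rightarrow> nat" where
  "metric_dim k X = Inf (card ` {S. k_metric_generator k X S})"

end

theory Submission
  imports Defs
begin

text \<open>Two vertices in the same copy of a factor are at the same distance from every vertex of another
  copy, and inside the copy the distance of the product is the distance of the factor truncated at 2.
  Hence a \<open>k\<close>-metric generator of the product restricts on every copy to a \<open>k\<close>-metric generator for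
  the truncated distance (a \<open>k\<close>-adjacency generator). Conversely, adjacency generators of the copies
  combine as soon as they also separate vertices of different copies, which minimal ones of paths and
  cycles can be chosen to do; so the dimension of the product is the sum of the \<open>k\<close>-adjacency
  dimensions of the factors.

  In a path or cycle, vertices at distance 1 are distinguished by the four consecutive vertices around
  them, vertices at distance 2 by five consecutive vertices except the middle one, and all other pairs
  by their disjoint closed neighbourhoods. Summing these conditions over all positions gives the lower
  bounds. They are attained by every second vertex for \<open>k = 2\<close>, by leaving out every fifth vertex
  for \<open>k = 3\<close>, and by all vertices for \<open>k = 4\<close>; near an end of a path windows are cut off, which forces
  the additional vertices there.\<close>

subsection \<open>Distances in the lexicographic product\<close>

text \<open>Passing from arc lists to powers of the arc relation lets distances be handled by
  induction on the length alone.\<close>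

lemma awalk_of_length_iff_relpow:
  assumes "pair_wf_digraph X" "v \<in> pverts X"
  shows "(\<exists>p. pre_digraph.awalk (with_proj X) v p w \<and> length p = l) \<longleftrightarrow> (v, w) \<in> parcs X ^^ l"
proof -
  interpret pair_wf_digraph X by fact
  show ?thesis
    using assms(2)
  proof (induction l arbitrary: v)
    case 0
    then show ?case by (auto simp: awalk_Nil_iff)
  next
    case (Suc l)
    show ?case
    proof
      assume "\<exists>p. awalk v p w \<and> length p = Suc l"
      then obtain e p where e: "awalk v (e # p) w" "length p = l"
        by (metis length_Suc_conv)
      then have "(v, snd e) \<in> parcs X" "awalk (snd e) p w"
        by (cases e; simp add: awalk_Cons_iff)+
      moreover from this have "(snd e, w) \<in> parcs X ^^ l"
        using Suc.IH e(2) in_arcsD2 by blast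
      ultimately show "(v, w) \<in> parcs X ^^ Suc l"
        by (blast intro: relpow_Suc_I2)
    next
      assume "(v, w) \<in> parcs X ^^ Suc l"
      then obtain z where z: "(v, z) \<in> parcs X" "(z, w) \<in> parcs X ^^ l"
        by (metis relpow_Suc_D2)
      then obtain p where "awalk z p w" "length p = l"
        using Suc.IH in_arcsD2 by blast
      then have "awalk v ((v, z) # p) w" "length ((v, z) # p) = Suc l"
        using z by (simp_all add: awalk_Cons_iff)
      then show "\<exists>p. awalk v p w \<and> length p = Suc l"
        by blast
    qed
  qed
qed

text \<open>With unit weights the cost of a walk is its length. For an unreachable \<open>w\<close>
  the infimum is over the empty set, hence infinite.\<close>

lemma graph_dist_eq_INF:
  assumes "pair_wf_digraph X" "v \<in> pverts X"
  shows "graph_dist X v w = (INF l\<in>{l. (v, w) \<in> parcs X ^^ l}. ereal (real l))"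
proof -
  interpret pair_wf_digraph X by fact
  have cost: "awalk_cost (\<lambda>_. 1) p = length p" for p
    by (induction p) auto
  have "(\<lambda>p. ereal (awalk_cost (\<lambda>_. 1) p)) ` {p. awalk v p w}
      = (\<lambda>l. ereal (real l)) ` {l. (v, w) \<in> parcs X ^^ l}"
    unfolding cost image_def using awalk_of_length_iff_relpow[OF assms, of w]
    by (intro Collect_cong) (metis mem_Collect_eq)
  then show ?thesis
    unfolding graph_dist_def \<mu>_def by simp
qed

lemma graph_dist_le:
  assumes "pair_wf_digraph X" "v \<in> pverts X" "(v, w) \<in> parcs X ^^ l"
  shows "graph_dist X v w \<le> ereal (real l)"
  unfolding graph_dist_eq_INF[OF assms(1,2)] using assms(3) by (auto intro: INF_lower)

lemma graph_dist_ge: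
  assumes "pair_wf_digraph X" "v \<in> pverts X" "\<And>l. (v, w) \<in> parcs X ^^ l \<Longrightarrow> m \<le> l"
  shows "ereal (real m) \<le> graph_dist X v w"
  unfolding graph_dist_eq_INF[OF assms(1,2)] using assms(3) by (auto intro: INF_greatest)

text \<open>Compares two distances without computing either, by replacing each walk by one that is
  no longer; infinite distances are covered.\<close>

lemma graph_dist_mono:
  assumes "pair_wf_digraph X" "v \<in> pverts X" "v' \<in> pverts X"
    and "\<And>l. (v, w) \<in> parcs X ^^ l \<Longrightarrow> \<exists>l'\<le>l. (v', w) \<in> parcs X ^^ l'"
  shows "graph_dist X v' w \<le> graph_dist X v w"
  unfolding graph_dist_eq_INF[OF assms(1,2)] graph_dist_eq_INF[OF assms(1,3)]
  using assms(4) by (intro INF_mono) auto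

lemma graph_dist_ge_1:
  assumes "pair_wf_digraph X" "v \<in> pverts X" "v \<noteq> w"
  shows "1 \<le> graph_dist X v w"
proof -
  have "1 \<le> l" if "(v, w) \<in> parcs X ^^ l" for l
    using that assms(3) by (cases l) simp_all
  from graph_dist_ge[OF assms(1,2) this] show ?thesis
    by (simp add: one_ereal_def)
qed

lemma graph_dist_ge_2:
  assumes "pair_wf_digraph X" "v \<in> pverts X" "v \<noteq> w" "(v, w) \<notin> parcs X"
  shows "2 \<le> graph_dist X v w"
proof -
  have "2 \<le> l" if l: "(v, w) \<in> parcs X ^^ l" for l
  proof (rule ccontr)
    assume "\<not> 2 \<le> l"
    then have "l = 0 \<or> l = 1" by linarith
    then show False using l assms(3,4) by (elim disjE) simp_all
  qed
  from graph_dist_ge[OF assms(1,2) this] show ?thesis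
    by simp
qed

lemma graph_dist_eq_0_iff:
  assumes "pair_wf_digraph X" "v \<in> pverts X"
  shows "graph_dist X v w = 0 \<longleftrightarrow> v = w"
proof
  assume "v = w"
  then have "graph_dist X v w \<le> ereal (real 0)"
    by (intro graph_dist_le assms) simp
  moreover have "ereal (real 0) \<le> graph_dist X v w"
    by (intro graph_dist_ge assms) simp
  ultimately show "graph_dist X v w = 0"
    by (simp add: zero_ereal_def)
next
  assume "graph_dist X v w = 0"
  then show "v = w"
    using graph_dist_ge_1[OF assms] by fastforce
qed

lemma graph_dist_eq_1_iff:
  assumes "pair_wf_digraph X" "v \<in> pverts X" "v \<noteq> w"
  shows "graph_dist X v w = 1 \<longleftrightarrow> (v, w) \<in> parcs X"
proof
  assume "(v, w) \<in> parcs X"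
  then have "graph_dist X v w \<le> ereal (real 1)"
    by (intro graph_dist_le assms) simp
  with graph_dist_ge_1[OF assms] show "graph_dist X v w = 1"
    by (simp add: one_ereal_def)
next
  assume "graph_dist X v w = 1"
  then show "(v, w) \<in> parcs X"
    using graph_dist_ge_2[OF assms] by fastforce
qed

lemma connected_obtains_neighbour:
  assumes "pair_graph G" "connected (with_proj G)" "v \<in> pverts G" "w \<in> pverts G" "v \<noteq> w"
  obtains z where "(v, z) \<in> parcs G"
proof -
  interpret pair_graph G by fact
  \<comment> \<open>\<open>connected\<close> speaks of the symmetrised graph, which has the same
    arcs because \<open>G\<close> is symmetric; the first arc of a walk from \<open>v\<close> to
    \<open>w\<close> gives the neighbour.\<close>
  have "v \<rightarrow>\<^sup>*\<^bsub>with_proj (mk_symmetric (with_proj G))\<^esub> w"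
    using assms by (auto simp: connected_def strongly_connected_def)
  then have "(v, w) \<in> (parcs (mk_symmetric (with_proj G)))\<^sup>*"
    by (auto simp: reachable_def rtrancl_on_def intro: rtrancl_on_rtranclI)
  then obtain z where "(v, z) \<in> parcs (mk_symmetric (with_proj G))"
    using assms(5) by (meson converse_rtranclE)
  then have "(v, z) \<in> parcs G"
    unfolding adj_mk_symmetric_eq[OF sym_arcs] .
  then show ?thesis
    by (rule that)
qed

section \<open>Truncated distance and adjacency generators\<close>

definition adj_dist :: "'a pair_pre_digraph \<Rightarrow> 'a \<Rightarrow> 'a \<Rightarrow> nat" where
  "adj_dist H v w = (if v = w then 0 else if (v, w) \<in> parcs H then 1 else 2)"

definition adjacency_generator :: "nat \<Rightarrow> 'a pair_pre_digraph \<Rightarrow> 'a set \<Rightarrow> bool" where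
  "adjacency_generator k H A \<longleftrightarrow> A \<subseteq> pverts H \<and>
     (\<forall>v\<in>pverts H. \<forall>w\<in>pverts H. v \<noteq> w \<longrightarrow> k \<le> card {a \<in> A. adj_dist H v a \<noteq> adj_dist H w a})"

text \<open>The last two conditions let two copies, contributing at least \<open>k / 2\<close> each, separate
  their vertices from each other: the vertices of the own copy at distance other than 1 do so if the
  copies are adjacent, those at distance at most 1 if they are not.\<close>

definition balanced_adjacency_generator :: "nat \<Rightarrow> 'a pair_pre_digraph \<Rightarrow> 'a set \<Rightarrow> bool" where
  "balanced_adjacency_generator k H A \<longleftrightarrow> adjacency_generator k H A \<and>
     (\<forall>v\<in>pverts H. k \<le> 2 * card {a \<in> A. adj_dist H v a \<noteq> 1} \<and>
       k \<le> 2 * card {a \<in> A. adj_dist H v a \<le> 1})"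

text \<open>This says that \<open>m\<close> is the \<open>k\<close>-adjacency dimension and that a
  balanced generator attains it. The lower bound ranges over all adjacency generators, since the
  slices of a metric generator need not be balanced.\<close>

definition balanced_adjacency_dim :: "nat \<Rightarrow> 'a pair_pre_digraph \<Rightarrow> nat \<Rightarrow> bool" where
  "balanced_adjacency_dim k H m \<longleftrightarrow> (\<exists>A. balanced_adjacency_generator k H A \<and> card A = m) \<and>
     (\<forall>A. adjacency_generator k H A \<longrightarrow> m \<le> card A)"

section \<open>The product and its copies of the factors\<close>

locale lex_factors =
  fixes G :: "'a pair_pre_digraph" and n :: nat and u :: "nat \<Rightarrow> 'a"
    and H :: "nat \<Rightarrow> 'b pair_pre_digraph" and I :: "nat set"
  defines "I \<equiv> {1..n}"
  assumes graph_G: "pair_graph G"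
    and connected_G: "connected (with_proj G)"
    and two_le_n: "2 \<le> n"
    and bij_u: "bij_betw u I (pverts G)"
    and finite_H: "\<And>i. i \<in> I \<Longrightarrow> finite (pverts (H i))"
    and nonempty_H: "\<And>i. i \<in> I \<Longrightarrow> pverts (H i) \<noteq> {}"
begin

abbreviation "X \<equiv> lex_product G n u H"

lemma u_eq_iff: "i \<in> I \<Longrightarrow> j \<in> I \<Longrightarrow> u i = u j \<longleftrightarrow> i = j"
  by (rule inj_on_eq_iff[OF bij_betw_imp_inj_on[OF bij_u]])

lemma pverts_X: "pverts X = (\<Union>i\<in>I. Pair (u i) ` pverts (H i))"
  by (auto simp: lex_product_def I_def)

lemma in_pverts_X: "i \<in> I \<Longrightarrow> (u i, v) \<in> pverts X \<longleftrightarrow> v \<in> pverts (H i)"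
  by (auto simp: pverts_X u_eq_iff)

lemma in_parcs_X:
  assumes "i \<in> I" "j \<in> I"
  shows "((u i, v), (u j, w)) \<in> parcs X \<longleftrightarrow> v \<in> pverts (H i) \<and> w \<in> pverts (H j) \<and>
    ((u i, u j) \<in> parcs G \<or> i = j \<and> (v, w) \<in> parcs (H i))"
proof
  assume "((u i, v), (u j, w)) \<in> parcs X"
  then obtain i' j' where "i' \<in> I" "j' \<in> I" "u i = u i'" "u j = u j'"
    and "v \<in> pverts (H i')" "w \<in> pverts (H j')"
      "(u i', u j') \<in> parcs G \<or> i' = j' \<and> (v, w) \<in> parcs (H i')"
    unfolding lex_product_def I_def by force
  moreover from this have "i' = i" "j' = j"
    using assms u_eq_iff by metis+
  ultimately show "v \<in> pverts (H i) \<and> w \<in> pverts (H j) \<and>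
      ((u i, u j) \<in> parcs G \<or> i = j \<and> (v, w) \<in> parcs (H i))"
    by simp
next
  assume "v \<in> pverts (H i) \<and> w \<in> pverts (H j) \<and>
      ((u i, u j) \<in> parcs G \<or> i = j \<and> (v, w) \<in> parcs (H i))"
  then show "((u i, v), (u j, w)) \<in> parcs X"
    using assms unfolding lex_product_def I_def by simp blast
qed

lemma wf_X: "pair_wf_digraph X"
  by unfold_locales (auto simp: lex_product_def)

lemma parcs_G_sym: "(a, b) \<in> parcs G \<Longrightarrow> (b, a) \<in> parcs G"
proof -
  interpret pair_graph G by (rule graph_G)
  show "(a, b) \<in> parcs G \<Longrightarrow> (b, a) \<in> parcs G" by (rule arcs_symmetric)
qed

lemma parcs_G_irrefl: "(a, a) \<notin> parcs G"
proof -
  interpret pair_graph G by (rule graph_G)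
  show ?thesis using no_loops' by blast
qed

lemma obtains_neighbour:
  assumes "i \<in> I"
  obtains j where "j \<in> I" "(u i, u j) \<in> parcs G"
proof -
  interpret pair_graph G by (rule graph_G)
  obtain l where l: "l \<in> I" "l \<noteq> i"
  proof (cases "i = 1")
    case True
    then show ?thesis using two_le_n that[of 2] by (simp add: I_def)
  next
    case False
    then show ?thesis using two_le_n that[of 1] by (simp add: I_def)
  qed
  have "u i \<in> pverts G" "u l \<in> pverts G" "u i \<noteq> u l"
    using bij_betwE[OF bij_u] assms l u_eq_iff by auto
  then obtain z where z: "(u i, z) \<in> parcs G"
    using connected_obtains_neighbour[OF graph_G connected_G] by blast
  then have "z \<in> u ` I"
    using in_arcsD2 bij_u by (auto simp: bij_betw_def)
  then show ?thesis using z that by blast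
qed

text \<open>Any vertex of an adjacent copy is a common neighbour of the whole copy, so no distance
  inside exceeds 2, even if the factor is disconnected.\<close>

lemma graph_dist_same_copy:
  assumes i: "i \<in> I" and v: "v \<in> pverts (H i)" and w: "w \<in> pverts (H i)"
  shows "graph_dist X (u i, v) (u i, w) = ereal (real (adj_dist (H i) v w))"
proof -
  have vX: "(u i, v) \<in> pverts X"
    using i v by (simp add: in_pverts_X)
  have arc: "((u i, v), (u i, w)) \<in> parcs X \<longleftrightarrow> (v, w) \<in> parcs (H i)"
    using in_parcs_X i v w parcs_G_irrefl by blast
  obtain j where j: "j \<in> I" "(u i, u j) \<in> parcs G"
    using obtains_neighbour[OF i] .
  obtain z where z: "z \<in> pverts (H j)"
    using nonempty_H[OF j(1)] by blast
  have "((u i, v), (u j, z)) \<in> parcs X" "((u j, z), (u i, w)) \<in> parcs X"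
    using i j z v w parcs_G_sym by (auto simp: in_parcs_X)
  then have "((u i, v), (u i, w)) \<in> parcs X ^^ 2"
    by (auto simp: numeral_2_eq_2)
  then have le: "graph_dist X (u i, v) (u i, w) \<le> 2"
    using graph_dist_le[OF wf_X vX] by fastforce
  consider "v = w" | "v \<noteq> w" "(v, w) \<in> parcs (H i)" | "v \<noteq> w" "(v, w) \<notin> parcs (H i)"
    by blast
  then show ?thesis
  proof cases
    case 1
    then show ?thesis using graph_dist_eq_0_iff[OF wf_X vX] by (simp add: adj_dist_def zero_ereal_def)
  next
    case 2
    then show ?thesis
      using graph_dist_eq_1_iff[OF wf_X vX] arc by (simp add: adj_dist_def one_ereal_def)
  next
    case 3
    then show ?thesis
      using graph_dist_ge_2[OF wf_X vX, of "(u i, w)"] arc le by (simp add: adj_dist_def)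
  qed
qed

text \<open>A walk leaving the copy of \<open>u i\<close> can leave it at its last visit from any vertex of
  that copy.\<close>

lemma relpow_leaving_copy:
  assumes i: "i \<in> I" and j: "j \<in> I" "i \<noteq> j"
    and "v' \<in> pverts (H i)" and "((u i, v), (u j, w)) \<in> parcs X ^^ l"
  shows "\<exists>l'\<le>l. ((u i, v'), (u j, w)) \<in> parcs X ^^ l'"
  using assms(5)
proof (induction l arbitrary: v)
  case 0
  then show ?case using u_eq_iff i j by auto
next
  case (Suc l)
  obtain y where y: "((u i, v), y) \<in> parcs X" "(y, (u j, w)) \<in> parcs X ^^ l"
    using Suc.prems by (metis relpow_Suc_D2)
  have "y \<in> pverts X"
    using y(1) by (auto simp: lex_product_def)
  then obtain m z where y_eq: "y = (u m, z)" and m: "m \<in> I"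
    by (auto simp: pverts_X)
  show ?case
  proof (cases "m = i")
    case True
    then show ?thesis using Suc.IH y(2) y_eq by (meson le_Suc_eq)
  next
    case False
    then have "((u i, v'), y) \<in> parcs X"
      using y(1) assms(4) i m by (auto simp: y_eq in_parcs_X)
    then have "((u i, v'), (u j, w)) \<in> parcs X ^^ Suc l"
      using y(2) by (rule relpow_Suc_I2)
    then show ?thesis by blast
  qed
qed

text \<open>Walks starting at \<open>v\<close> and at \<open>v'\<close> can be exchanged in either
  direction without becoming longer.\<close>

lemma graph_dist_other_copy:
  assumes "i \<in> I" "j \<in> I" "i \<noteq> j" "v \<in> pverts (H i)" "v' \<in> pverts (H i)"
  shows "graph_dist X (u i, v) (u j, w) = graph_dist X (u i, v') (u j, w)"
proof -
  have "(u i, v) \<in> pverts X" "(u i, v') \<in> pverts X"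
    using assms by (simp_all add: in_pverts_X)
  then show ?thesis
    using assms by (intro antisym graph_dist_mono[OF wf_X] relpow_leaving_copy)
qed

lemma graph_dist_other_copy_eq_1_iff:
  assumes "i \<in> I" "j \<in> I" "i \<noteq> j" "v \<in> pverts (H i)" "w \<in> pverts (H j)"
  shows "graph_dist X (u i, v) (u j, w) = 1 \<longleftrightarrow> (u i, u j) \<in> parcs G"
  using assms u_eq_iff graph_dist_eq_1_iff[OF wf_X, of "(u i, v)" "(u j, w)"]
  by (auto simp: in_pverts_X in_parcs_X)

definition slice :: "('a \<times> 'b) set \<Rightarrow> nat \<Rightarrow> 'b set" where
  "slice S i = {v. (u i, v) \<in> S}"

lemma slice_pverts: "S \<subseteq> pverts X \<Longrightarrow> i \<in> I \<Longrightarrow> slice S i \<subseteq> pverts (H i)"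
  using in_pverts_X by (auto simp: slice_def)

lemma card_eq_sum_slices:
  assumes "S \<subseteq> pverts X"
  shows "card S = (\<Sum>i\<in>I. card (slice S i))"
proof -
  have "S = (\<Union>i\<in>I. Pair (u i) ` slice S i)"
    using assms by (fastforce simp: slice_def pverts_X)
  also have "card \<dots> = (\<Sum>i\<in>I. card (Pair (u i) ` slice S i))"
  proof (rule card_UN_disjoint)
    show "finite I" by (simp add: I_def)
    show "\<forall>i\<in>I. finite (Pair (u i) ` slice S i)"
      using slice_pverts[OF assms] finite_H by (blast intro: finite_subset)
    show "\<forall>i\<in>I. \<forall>j\<in>I. i \<noteq> j \<longrightarrow> Pair (u i) ` slice S i \<inter> Pair (u j) ` slice S j = {}"
      using u_eq_iff by auto
  qed
  also have "\<dots> = (\<Sum>i\<in>I. card (slice S i))"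
    by (intro sum.cong card_image) (auto intro: inj_onI)
  finally show ?thesis .
qed

text \<open>The other copies contribute nothing, because both vertices have equal distances to
  them.\<close>

lemma card_distinguishing_same_copy:
  assumes S: "S \<subseteq> pverts X" and i: "i \<in> I" and v: "v \<in> pverts (H i)" "v' \<in> pverts (H i)"
  shows "card {w \<in> S. graph_dist X (u i, v) w \<noteq> graph_dist X (u i, v') w}
    = card {a \<in> slice S i. adj_dist (H i) v a \<noteq> adj_dist (H i) v' a}"
proof -
  have "{w \<in> S. graph_dist X (u i, v) w \<noteq> graph_dist X (u i, v') w}
      = Pair (u i) ` {a \<in> slice S i. adj_dist (H i) v a \<noteq> adj_dist (H i) v' a}" (is "?L = ?R")
  proof (intro equalityI subsetI)
    fix x assume x: "x \<in> ?L"
    then obtain j w where x_eq: "x = (u j, w)" "j \<in> I" "w \<in> pverts (H j)"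
      using S by (auto simp: pverts_X)
    then have "j = i"
      using x graph_dist_other_copy[OF i, of j v v' w] v by auto
    then show "x \<in> ?R"
      using x x_eq graph_dist_same_copy[OF i] v by (auto simp: slice_def)
  next
    fix x assume "x \<in> ?R"
    then obtain a where a: "x = (u i, a)" "a \<in> slice S i" "adj_dist (H i) v a \<noteq> adj_dist (H i) v' a"
      by blast
    then show "x \<in> ?L"
      using slice_pverts[OF S i] graph_dist_same_copy[OF i] v by (auto simp: slice_def)
  qed
  then show ?thesis by (simp add: card_image inj_on_def)
qed

text \<open>This is the source of the lower bound: pairs inside one copy can only be distinguished
  by the slice of that copy.\<close>

lemma k_metric_generator_slice:
  assumes "k_metric_generator k X S" and i: "i \<in> I"
  shows "adjacency_generator k (H i) (slice S i)"
proof -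
  have S: "S \<subseteq> pverts X"
    using assms(1) by (simp add: k_metric_generator_def)
  have "k \<le> card {a \<in> slice S i. adj_dist (H i) v a \<noteq> adj_dist (H i) w a}"
    if "v \<in> pverts (H i)" "w \<in> pverts (H i)" "v \<noteq> w" for v w
  proof -
    have "(u i, v) \<in> pverts X" "(u i, w) \<in> pverts X" "(u i, v) \<noteq> (u i, w)"
      using that i by (simp_all add: in_pverts_X)
    then have "k \<le> card {z \<in> S. graph_dist X (u i, v) z \<noteq> graph_dist X (u i, w) z}"
      using assms(1) by (simp add: k_metric_generator_def)
    then show ?thesis
      by (simp only: card_distinguishing_same_copy[OF S i that(1,2)])
  qed
  then show ?thesis
    using slice_pverts[OF S i] by (auto simp: adjacency_generator_def)
qed

text \<open>Seen from the copy \<open>j\<close>, the vertices of the copy \<open>i\<close> look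
  alike: all at distance 1 if the copies are adjacent, all at distance at least 2 if not. Hence
  \<open>a\<close> distinguishes as soon as its distance from \<open>v\<close> is of the other
  kind.\<close>

lemma distinguishing_other_copy:
  assumes i: "i \<in> I" and j: "j \<in> I" "i \<noteq> j"
    and v: "v \<in> pverts (H i)" and w: "w \<in> pverts (H j)" and a: "a \<in> pverts (H i)"
    and "if (u j, u i) \<in> parcs G then adj_dist (H i) v a \<noteq> 1 else adj_dist (H i) v a \<le> 1"
  shows "graph_dist X (u i, v) (u i, a) \<noteq> graph_dist X (u j, w) (u i, a)"
proof (cases "(u j, u i) \<in> parcs G")
  case True
  then have "graph_dist X (u j, w) (u i, a) = 1"
    using graph_dist_other_copy_eq_1_iff i j w a by auto
  then show ?thesis
    using True assms(7) graph_dist_same_copy[OF i v a] by (simp add: one_ereal_def)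
next
  case False
  then have "2 \<le> graph_dist X (u j, w) (u i, a)"
    using i j w a u_eq_iff by (intro graph_dist_ge_2[OF wf_X]) (auto simp: in_pverts_X in_parcs_X)
  moreover have "graph_dist X (u i, v) (u i, a) \<le> 1"
    using False assms(7) graph_dist_same_copy[OF i v a] by (simp add: one_ereal_def)
  ultimately show ?thesis
    using order_trans by fastforce
qed

text \<open>This is the source of the upper bound. Pairs in one copy are handled by its own
  generator, pairs in different copies by the balance conditions.\<close>

lemma k_metric_generator_Union:
  assumes A: "\<And>i. i \<in> I \<Longrightarrow> balanced_adjacency_generator k (H i) (A i)"
  shows "k_metric_generator k X (\<Union>i\<in>I. Pair (u i) ` A i)"
    and "card (\<Union>i\<in>I. Pair (u i) ` A i) = (\<Sum>i\<in>I. card (A i))"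
proof -
  define S where "S = (\<Union>i\<in>I. Pair (u i) ` A i)"
  have finite_I: "finite I"
    by (simp add: I_def)
  have A_sub: "A i \<subseteq> pverts (H i)" if "i \<in> I" for i
    using A[OF that] by (simp add: balanced_adjacency_generator_def adjacency_generator_def)
  then have S: "S \<subseteq> pverts X"
    by (auto simp: S_def pverts_X)
  have finite_S: "finite S"
    unfolding S_def using A_sub finite_H finite_subset
    by (intro finite_UN_I[OF finite_I] finite_imageI) blast
  have slice: "slice S i = A i" if "i \<in> I" for i
    using that by (auto simp: slice_def S_def u_eq_iff)
  \<comment> \<open>The elements of \<open>A i\<close> that separate \<open>v\<close> from every
    vertex of the copy \<open>j\<close>.\<close>
  define far where "far i j v = {a \<in> A i. if (u j, u i) \<in> parcs G
      then adj_dist (H i) v a \<noteq> 1 else adj_dist (H i) v a \<le> 1}" for i j v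
  have far: "k \<le> 2 * card (far i j v)" if "i \<in> I" "v \<in> pverts (H i)" for i j v
    using A[OF that(1)] that(2)
    by (cases "(u j, u i) \<in> parcs G") (simp_all add: balanced_adjacency_generator_def far_def)
  have "k \<le> card {z \<in> S. graph_dist X x z \<noteq> graph_dist X y z}"
    if "x \<in> pverts X" "y \<in> pverts X" "x \<noteq> y" for x y
  proof -
    obtain i v where x: "x = (u i, v)" "i \<in> I" "v \<in> pverts (H i)"
      using \<open>x \<in> pverts X\<close> by (auto simp: pverts_X)
    obtain j w where y: "y = (u j, w)" "j \<in> I" "w \<in> pverts (H j)"
      using \<open>y \<in> pverts X\<close> by (auto simp: pverts_X)
    show ?thesis
    proof (cases "i = j")
      case True
      then have "v \<noteq> w" using x y \<open>x \<noteq> y\<close> by auto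
      then show ?thesis
        using card_distinguishing_same_copy[OF S x(2,3), of w] A[OF x(2)] x y True slice[OF x(2)]
        by (simp add: balanced_adjacency_generator_def adjacency_generator_def)
    next
      case False
      have fin: "finite (far i j v)" "finite (far j i w)"
        using finite_subset[OF A_sub finite_H] x y by (simp_all add: far_def)
      \<comment> \<open>Each copy supplies at least \<open>k / 2\<close> vertices, rounded up for
        odd \<open>k\<close>, and the two sets lie in different copies.\<close>
      have "k \<le> card (far i j v) + card (far j i w)"
        using far[OF x(2,3), of j] far[OF y(2,3), of i] by linarith
      also have "\<dots> = card (Pair (u i) ` far i j v) + card (Pair (u j) ` far j i w)"
        by (simp add: card_image inj_on_def)
      also have "\<dots> = card (Pair (u i) ` far i j v \<union> Pair (u j) ` far j i w)"
        using fin x y False by (intro card_Un_disjoint[symmetric]) (auto simp: u_eq_iff)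
      also have "\<dots> \<le> card {z \<in> S. graph_dist X x z \<noteq> graph_dist X y z}"
      proof (rule card_mono)
        show "finite {z \<in> S. graph_dist X x z \<noteq> graph_dist X y z}"
          using finite_S by simp
        have "graph_dist X x (u i, a) \<noteq> graph_dist X y (u i, a)" if "a \<in> far i j v" for a
        proof -
          have "a \<in> pverts (H i)" using that x(2) A_sub by (auto simp: far_def)
          moreover have "if (u j, u i) \<in> parcs G then adj_dist (H i) v a \<noteq> 1 else adj_dist (H i) v a \<le> 1"
            using that unfolding far_def by blast
          ultimately show ?thesis
            unfolding x(1) y(1) by (rule distinguishing_other_copy[OF x(2) y(2) False x(3) y(3)])
        qed
        moreover have "graph_dist X x (u j, a) \<noteq> graph_dist X y (u j, a)" if "a \<in> far j i w" for a
        proof -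
          have "a \<in> pverts (H j)" using that y(2) A_sub by (auto simp: far_def)
          moreover have "if (u i, u j) \<in> parcs G then adj_dist (H j) w a \<noteq> 1 else adj_dist (H j) w a \<le> 1"
            using that unfolding far_def by blast
          ultimately show ?thesis
            unfolding x(1) y(1)
            by (rule distinguishing_other_copy[OF y(2) x(2) False[symmetric] y(3) x(3), symmetric])
        qed
        ultimately show "Pair (u i) ` far i j v \<union> Pair (u j) ` far j i w
            \<subseteq> {z \<in> S. graph_dist X x z \<noteq> graph_dist X y z}"
          using x y by (auto simp: S_def far_def)
      qed
      finally show ?thesis .
    qed
  qed
  then show "k_metric_generator k X (\<Union>i\<in>I. Pair (u i) ` A i)"
    using S by (simp add: k_metric_generator_def flip: S_def)
  show "card (\<Union>i\<in>I. Pair (u i) ` A i) = (\<Sum>i\<in>I. card (A i))"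
    using card_eq_sum_slices[OF S] slice by (simp flip: S_def)
qed

text \<open>Cardinalities add up over the slices, so the two bounds meet copy by copy; the balanced
  generators provide the set at which the infimum is attained.\<close>

theorem metric_dim_eq_sum:
  assumes m: "\<And>i. i \<in> I \<Longrightarrow> balanced_adjacency_dim k (H i) (m i)"
  shows "metric_dim k X = (\<Sum>i\<in>I. m i)"
  unfolding metric_dim_def
proof (rule cInf_eq_minimum)
  obtain A where A: "\<And>i. i \<in> I \<Longrightarrow> balanced_adjacency_generator k (H i) (A i) \<and> card (A i) = m i"
    using m unfolding balanced_adjacency_dim_def by metis
  let ?S = "\<Union>i\<in>I. Pair (u i) ` A i"
  have "k_metric_generator k X ?S" "card ?S = (\<Sum>i\<in>I. m i)"
    using k_metric_generator_Union[of k A] A by simp_all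
  then show "(\<Sum>i\<in>I. m i) \<in> card ` {S. k_metric_generator k X S}"
    by (intro image_eqI[of _ _ ?S]) simp_all
next
  fix c assume "c \<in> card ` {S. k_metric_generator k X S}"
  then obtain S where S: "k_metric_generator k X S" "c = card S"
    by blast
  then have "S \<subseteq> pverts X"
    by (simp add: k_metric_generator_def)
  then have "c = (\<Sum>i\<in>I. card (slice S i))"
    unfolding S(2) by (rule card_eq_sum_slices)
  also have "\<dots> \<ge> (\<Sum>i\<in>I. m i)"
    using m k_metric_generator_slice[OF S(1)] unfolding balanced_adjacency_dim_def
    by (intro sum_mono) blast
  finally show "(\<Sum>i\<in>I. m i) \<le> c" .
qed

end

section \<open>Counting lemmas shared by paths and cycles\<close>

text \<open>Rewrites a count within \<open>A\<close> as a sum of indicators over an explicit window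
  \<open>D\<close>, which linear arithmetic can handle.\<close>

lemma card_conj_eq_sum_of_bool:
  assumes "finite D" "\<And>a. a \<in> A \<Longrightarrow> P a \<longleftrightarrow> a \<in> D"
  shows "card {a \<in> A. P a} = (\<Sum>a\<in>D. of_bool (a \<in> A))"
proof -
  have "{a \<in> A. P a} = D \<inter> {a. a \<in> A}"
    using assms(2) by auto
  then show ?thesis
    using assms(1) by (simp add: sum_of_bool_eq)
qed

text \<open>When the closed neighbourhoods share no element of \<open>A\<close>, every element of
  either one is at distance at most 1 from one vertex and 2 from the other. The halves from the
  balance condition then add up to \<open>k\<close>.\<close>

lemma card_adj_dist_neq_if_far:
  assumes "finite A"
    and "k \<le> 2 * card {a \<in> A. adj_dist H v a \<le> 1}" "k \<le> 2 * card {a \<in> A. adj_dist H w a \<le> 1}"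
    and "\<And>a. a \<in> A \<Longrightarrow> adj_dist H v a \<le> 1 \<Longrightarrow> adj_dist H w a \<le> 1 \<Longrightarrow> False"
  shows "k \<le> card {a \<in> A. adj_dist H v a \<noteq> adj_dist H w a}"
proof -
  have "k \<le> card {a \<in> A. adj_dist H v a \<le> 1} + card {a \<in> A. adj_dist H w a \<le> 1}"
    using assms(2,3) by linarith
  also have "\<dots> = card ({a \<in> A. adj_dist H v a \<le> 1} \<union> {a \<in> A. adj_dist H w a \<le> 1})"
    using assms(1,4) by (intro card_Un_disjoint[symmetric]) auto
  also have "\<dots> \<le> card {a \<in> A. adj_dist H v a \<noteq> adj_dist H w a}"
  proof (rule card_mono)
    show "finite {a \<in> A. adj_dist H v a \<noteq> adj_dist H w a}"
      using assms(1) by simp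
    show "{a \<in> A. adj_dist H v a \<le> 1} \<union> {a \<in> A. adj_dist H w a \<le> 1}
        \<subseteq> {a \<in> A. adj_dist H v a \<noteq> adj_dist H w a}"
      using assms(4) by auto metis+
  qed
  finally show ?thesis .
qed

text \<open>In a graph of maximum degree 2 at most two elements of \<open>A\<close> are at distance
  1 from \<open>v\<close>, so this balance condition follows from the size of
  \<open>A\<close>.\<close>

lemma card_adj_dist_neq_1:
  assumes "finite A" "\<And>a. a \<in> A \<Longrightarrow> adj_dist H v a = 1 \<Longrightarrow> a = b \<or> a = c"
    and "k + 4 \<le> 2 * card A"
  shows "k \<le> 2 * card {a \<in> A. adj_dist H v a \<noteq> 1}"
proof -
  have "A \<subseteq> {a \<in> A. adj_dist H v a \<noteq> 1} \<union> {b, c}"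
    using assms(2) by auto
  then have "card A \<le> card ({a \<in> A. adj_dist H v a \<noteq> 1} \<union> {b, c})"
    using assms(1) by (intro card_mono) auto
  also have "\<dots> \<le> card {a \<in> A. adj_dist H v a \<noteq> 1} + card {b, c}"
    by (rule card_Un_le)
  also have "\<dots> \<le> card {a \<in> A. adj_dist H v a \<noteq> 1} + 2"
    by (simp add: card_insert_if)
  finally show ?thesis using assms(3) by simp
qed

lemma card_less_Suc_Collect:
  "card {w. w < Suc q \<and> P w} = card {w. w < q \<and> P w} + of_bool (P q)"
proof (cases "P q")
  case True
  then have "{w. w < Suc q \<and> P w} = insert q {w. w < q \<and> P w}"
    by (auto simp: less_Suc_eq)
  then show ?thesis using True by simp
next
  case False
  then have "{w. w < Suc q \<and> P w} = {w. w < q \<and> P w}"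
    by (auto simp: less_Suc_eq)
  then show ?thesis using False by simp
qed

lemma card_even_less: "card {w. w < q \<and> even w} = (q + 1) div 2"
proof (induction q)
  case (Suc q)
  have "(Suc q + 1) div 2 = (q + 1) div 2 + of_bool (even q)"
    unfolding of_bool_def by presburger
  then show ?case
    using Suc by (simp add: card_less_Suc_Collect)
qed simp

lemma card_mod_5_neq_4_less: "card {w. w < q \<and> w mod 5 \<noteq> 4} = q - q div 5" for q :: nat
proof (induction q)
  case (Suc q)
  have "q div 5 \<le> q" by simp
  then have "Suc q - Suc q div 5 = q - q div 5 + of_bool (q mod 5 \<noteq> 4)"
    by (auto simp: div_Suc mod_Suc Suc_diff_le)
  then show ?case
    using Suc by (simp add: card_less_Suc_Collect)
qed simp

lemma at_most_one_residue_mod_5: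
  fixes i r :: nat
  shows "(4::nat) \<le> of_bool (i mod 5 \<noteq> r) + of_bool ((i + 1) mod 5 \<noteq> r) + of_bool ((i + 2) mod 5 \<noteq> r)
    + of_bool ((i + 3) mod 5 \<noteq> r) + of_bool ((i + 4) mod 5 \<noteq> r)"
proof -
  have residue: "(i + c) mod 5 = (i mod 5 + c) mod 5" for c
    by (simp add: mod_add_left_eq)
  have "i mod 5 < 5" by simp
  then consider "i mod 5 = 0" | "i mod 5 = 1" | "i mod 5 = 2" | "i mod 5 = 3" | "i mod 5 = 4"
    by linarith
  then show ?thesis
    unfolding residue by cases (simp_all only:, auto)
qed


subsection \<open>Cycles\<close>

text \<open>The indicator of \<open>A\<close> read cyclically, so that windows running past the
  vertex \<open>q - 1\<close> need no separate notation.\<close>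

definition cycle_ind :: "nat \<Rightarrow> nat set \<Rightarrow> nat \<Rightarrow> nat" where
  "cycle_ind q A i = of_bool (i mod q \<in> A)"

lemma cycle_ind_le: "cycle_ind q A i \<le> 1"
  by (simp add: cycle_ind_def)

lemma pverts_cycle_graph [simp]: "pverts (cycle_graph q) = {..<q}"
  by (simp add: cycle_graph_def)

lemma add_mod_if:
  fixes q :: nat
  assumes "5 \<le> q" "i < q"
  shows "i mod q = i"
    and "(i + 1) mod q = (if i + 1 < q then i + 1 else 0)"
    and "(i + 2) mod q = (if i + 2 < q then i + 2 else i + 2 - q)"
    and "(i + 3) mod q = (if i + 3 < q then i + 3 else i + 3 - q)"
    and "(i + 4) mod q = (if i + 4 < q then i + 4 else i + 4 - q)"
  using assms by (auto simp: le_mod_geq)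

lemma adj_dist_cycle_graph:
  assumes "v < q" "w < q"
  shows "adj_dist (cycle_graph q) v w = (if v = w then 0 else if w = v + 1 \<or> v = w + 1
    \<or> v = 0 \<and> w + 1 = q \<or> w = 0 \<and> v + 1 = q then 1 else 2)"
  using assms by (auto simp: adj_dist_def cycle_graph_def mod_Suc)

text \<open>Separates the windows of five that do not wrap around from those starting at one of the
  last four vertices.\<close>

lemma less_cases_4:
  fixes q :: nat
  assumes "i < q"
  obtains "i + 4 < q" | "q = i + 1" | "q = i + 2" | "q = i + 3" | "q = i + 4"
  using assms by linarith

lemma rotation_eq_iff:
  fixes q :: nat
  assumes "v < q" "w < q"
  shows "(i + v) mod q = (i + w) mod q \<longleftrightarrow> v = w"
proof
  have le: "w \<le> v" if "(i + v) mod q = (i + w) mod q" "w < q" for v w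
  proof (rule ccontr)
    assume "\<not> w \<le> v"
    then have "q dvd (i + w) - (i + v)"
      using that(1) by (metis add_left_mono linear mod_eq_dvd_iff_nat)
    then have "q \<le> w - v"
      using \<open>\<not> w \<le> v\<close> by (intro dvd_imp_le) simp_all
    then show False
      using that(2) \<open>\<not> w \<le> v\<close> by linarith
  qed
  assume "(i + v) mod q = (i + w) mod q"
  then show "v = w"
    using le[of v w] le[of w v] assms by simp
qed simp

lemma rotation_surj:
  fixes q :: nat
  assumes "a < q"
  obtains b where "b < q" "a = (i + b) mod q"
proof
  \<comment> \<open>The witness is \<open>a - i\<close> modulo \<open>q\<close>, written so that no
    subtraction is truncated.\<close>
  show "(a + (q - i mod q)) mod q < q"
    using assms by simp
  have "i mod q + (a + (q - i mod q)) = a + q"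
    using assms mod_less_divisor[of q i] by linarith
  then show "a = (i + (a + (q - i mod q)) mod q) mod q"
    using assms by (metis mod_add_left_eq mod_add_right_eq mod_add_self2 mod_less)
qed

text \<open>Rotations are automorphisms of the cycle, so statements about a pair need to be checked
  at one position only.\<close>

lemma adj_dist_cycle_rotation:
  assumes "v < q" "w < q"
  shows "adj_dist (cycle_graph q) ((i + v) mod q) ((i + w) mod q) = adj_dist (cycle_graph q) v w"
proof -
  have lt: "Suc x mod q < q" for x
    using assms by simp
  have "(i + y) mod q = Suc ((i + x) mod q) mod q \<longleftrightarrow> y = Suc x mod q" if "y < q" for x y
  proof -
    have "Suc ((i + x) mod q) mod q = (i + Suc x mod q) mod q"
      by (metis add_Suc_right mod_Suc_eq mod_add_right_eq)
    then show ?thesis by (simp only: rotation_eq_iff[OF that lt])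
  qed
  then show ?thesis
    using assms by (simp add: adj_dist_def cycle_graph_def rotation_eq_iff)
qed

text \<open>After a rotation the pair is 1 and 2. The window is indexed by its first vertex
  \<open>i\<close>, the vertex just before the pair.\<close>

lemma distinguishing_cycle_1:
  assumes "5 \<le> q" "a < q"
  shows "adj_dist (cycle_graph q) ((i + 1) mod q) a \<noteq> adj_dist (cycle_graph q) ((i + 2) mod q) a
    \<longleftrightarrow> a \<in> {i mod q, (i + 1) mod q, (i + 2) mod q, (i + 3) mod q}"
proof -
  obtain b where b: "b < q" "a = (i + b) mod q"
    using rotation_surj[OF assms(2), of i] .
  have lt: "0 < q" "1 < q" "2 < q" "3 < q"
    using assms(1) by simp_all
  have "adj_dist (cycle_graph q) 1 b \<noteq> adj_dist (cycle_graph q) 2 b \<longleftrightarrow> b \<in> {0, 1, 2, 3}"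
    unfolding adj_dist_cycle_graph[OF lt(2) b(1)] adj_dist_cycle_graph[OF lt(3) b(1)]
    using assms(1) by auto
  then show ?thesis
    using rotation_eq_iff[OF b(1) lt(1), of i]
    by (simp only: b(2) adj_dist_cycle_rotation[OF lt(2) b(1)] adj_dist_cycle_rotation[OF lt(3) b(1)]
        insert_iff empty_iff rotation_eq_iff[OF b(1) lt(2)] rotation_eq_iff[OF b(1) lt(3)]
        rotation_eq_iff[OF b(1) lt(4)] add_0_right)
qed

text \<open>After a rotation the pair is 1 and 3; the middle vertex 2 is adjacent to both and drops
  out. As \<open>5 \<le> q\<close>, the outer neighbours 0 and 4 are distinct.\<close>

lemma distinguishing_cycle_2:
  assumes "5 \<le> q" "a < q"
  shows "adj_dist (cycle_graph q) ((i + 1) mod q) a \<noteq> adj_dist (cycle_graph q) ((i + 3) mod q) a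
    \<longleftrightarrow> a \<in> {i mod q, (i + 1) mod q, (i + 3) mod q, (i + 4) mod q}"
proof -
  obtain b where b: "b < q" "a = (i + b) mod q"
    using rotation_surj[OF assms(2), of i] .
  have lt: "0 < q" "1 < q" "3 < q" "4 < q"
    using assms(1) by simp_all
  have "adj_dist (cycle_graph q) 1 b \<noteq> adj_dist (cycle_graph q) 3 b \<longleftrightarrow> b \<in> {0, 1, 3, 4}"
    unfolding adj_dist_cycle_graph[OF lt(2) b(1)] adj_dist_cycle_graph[OF lt(3) b(1)]
    using assms(1) by auto
  then show ?thesis
    using rotation_eq_iff[OF b(1) lt(1), of i]
    by (simp only: b(2) adj_dist_cycle_rotation[OF lt(2) b(1)] adj_dist_cycle_rotation[OF lt(3) b(1)]
        insert_iff empty_iff rotation_eq_iff[OF b(1) lt(2)] rotation_eq_iff[OF b(1) lt(3)]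
        rotation_eq_iff[OF b(1) lt(4)] add_0_right)
qed

lemma closed_neighbourhood_cycle:
  assumes "5 \<le> q" "a < q"
  shows "adj_dist (cycle_graph q) ((i + 1) mod q) a \<le> 1
    \<longleftrightarrow> a \<in> {i mod q, (i + 1) mod q, (i + 2) mod q}"
proof -
  obtain b where b: "b < q" "a = (i + b) mod q"
    using rotation_surj[OF assms(2), of i] .
  have lt: "0 < q" "1 < q" "2 < q"
    using assms(1) by simp_all
  have "adj_dist (cycle_graph q) 1 b \<le> 1 \<longleftrightarrow> b \<in> {0, 1, 2}"
    unfolding adj_dist_cycle_graph[OF lt(2) b(1)] using assms(1) by auto
  then show ?thesis
    using rotation_eq_iff[OF b(1) lt(1), of i]
    by (simp only: b(2) adj_dist_cycle_rotation[OF lt(2) b(1)] insert_iff empty_iff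
        rotation_eq_iff[OF b(1) lt(2)] rotation_eq_iff[OF b(1) lt(3)] add_0_right)
qed

text \<open>Both arcs between the vertices have length at least 3, so their closed neighbourhoods
  are disjoint.\<close>

lemma far_cycle:
  assumes "v < q" "3 \<le> d" "d + 3 \<le> q" "a < q"
    and "adj_dist (cycle_graph q) v a \<le> 1" "adj_dist (cycle_graph q) ((v + d) mod q) a \<le> 1"
  shows False
proof -
  obtain b where b: "b < q" "a = (v + b) mod q"
    using rotation_surj[OF assms(4), of v] .
  have lt: "0 < q" "d < q"
    using assms by simp_all
  have "adj_dist (cycle_graph q) 0 b \<le> 1" "adj_dist (cycle_graph q) d b \<le> 1"
    using assms(1,5,6) adj_dist_cycle_rotation[OF lt(1) b(1), of v]
      adj_dist_cycle_rotation[OF lt(2) b(1), of v] by (simp_all add: b(2))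
  then show False
    unfolding adj_dist_cycle_graph[OF lt(1) b(1)] adj_dist_cycle_graph[OF lt(2) b(1)]
    using assms(2,3) by (auto split: if_splits)
qed

lemma add_mod_neq: "5 \<le> q \<Longrightarrow> c < d \<Longrightarrow> d \<le> 4 \<Longrightarrow> (i + c) mod q \<noteq> (i + d) mod q" for q :: nat
  by (simp add: rotation_eq_iff)

lemma distinct_rotations:
  assumes "5 \<le> (q :: nat)"
  shows "distinct [i mod q, (i + 1) mod q, (i + 2) mod q, (i + 3) mod q, (i + 4) mod q]"
proof -
  have "inj_on (\<lambda>c. (i + c) mod q) {0, 1, 2, 3, 4}"
  proof (rule inj_on_subset)
    show "inj_on (\<lambda>c. (i + c) mod q) {..<q}"
      by (intro inj_onI) (simp add: rotation_eq_iff)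
  qed (use assms in auto)
  then have "distinct (map (\<lambda>c. (i + c) mod q) [0, 1, 2, 3, 4])"
    by (simp add: distinct_map)
  then show ?thesis
    by (simp only: list.map add_0_right)
qed

lemma card_distinguishing_cycle_1:
  assumes "5 \<le> q" "A \<subseteq> {..<q}"
  shows "card {a \<in> A. adj_dist (cycle_graph q) ((i + 1) mod q) a
      \<noteq> adj_dist (cycle_graph q) ((i + 2) mod q) a}
    = cycle_ind q A i + cycle_ind q A (i + 1) + cycle_ind q A (i + 2) + cycle_ind q A (i + 3)" (is "_ = ?rhs")
proof -
  have "card {a \<in> A. adj_dist (cycle_graph q) ((i + 1) mod q) a
      \<noteq> adj_dist (cycle_graph q) ((i + 2) mod q) a}
      = (\<Sum>a\<in>{i mod q, (i + 1) mod q, (i + 2) mod q, (i + 3) mod q}. of_bool (a \<in> A))"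
    using assms by (intro card_conj_eq_sum_of_bool distinguishing_cycle_1) auto
  also have "\<dots> = ?rhs"
    using distinct_rotations[OF assms(1), of i] unfolding cycle_ind_def by simp
  finally show ?thesis .
qed

lemma card_distinguishing_cycle_2:
  assumes "5 \<le> q" "A \<subseteq> {..<q}"
  shows "card {a \<in> A. adj_dist (cycle_graph q) ((i + 1) mod q) a
      \<noteq> adj_dist (cycle_graph q) ((i + 3) mod q) a}
    = cycle_ind q A i + cycle_ind q A (i + 1) + cycle_ind q A (i + 3) + cycle_ind q A (i + 4)" (is "_ = ?rhs")
proof -
  have "card {a \<in> A. adj_dist (cycle_graph q) ((i + 1) mod q) a
      \<noteq> adj_dist (cycle_graph q) ((i + 3) mod q) a}
      = (\<Sum>a\<in>{i mod q, (i + 1) mod q, (i + 3) mod q, (i + 4) mod q}. of_bool (a \<in> A))"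
    using assms by (intro card_conj_eq_sum_of_bool distinguishing_cycle_2) auto
  also have "\<dots> = ?rhs"
    using distinct_rotations[OF assms(1), of i] unfolding cycle_ind_def by simp
  finally show ?thesis .
qed

lemma card_closed_neighbourhood_cycle:
  assumes "5 \<le> q" "A \<subseteq> {..<q}"
  shows "card {a \<in> A. adj_dist (cycle_graph q) ((i + 1) mod q) a \<le> 1}
    = cycle_ind q A i + cycle_ind q A (i + 1) + cycle_ind q A (i + 2)" (is "_ = ?rhs")
proof -
  have "card {a \<in> A. adj_dist (cycle_graph q) ((i + 1) mod q) a \<le> 1}
      = (\<Sum>a\<in>{i mod q, (i + 1) mod q, (i + 2) mod q}. of_bool (a \<in> A))"
    using assms by (intro card_conj_eq_sum_of_bool closed_neighbourhood_cycle) auto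
  also have "\<dots> = ?rhs"
    using distinct_rotations[OF assms(1), of i] unfolding cycle_ind_def by simp
  finally show ?thesis .
qed

text \<open>The conditions for the pairs at distance 1 and 2; the lower bounds use only
  these.\<close>

lemma adjacency_generator_cycle_windows:
  assumes "5 \<le> q" "adjacency_generator k (cycle_graph q) A"
  shows "k \<le> cycle_ind q A i + cycle_ind q A (i + 1) + cycle_ind q A (i + 2) + cycle_ind q A (i + 3)"
    and "k \<le> cycle_ind q A i + cycle_ind q A (i + 1) + cycle_ind q A (i + 3) + cycle_ind q A (i + 4)"
proof -
  have A: "A \<subseteq> {..<q}"
    and k: "\<And>v w. v < q \<Longrightarrow> w < q \<Longrightarrow> v \<noteq> w \<Longrightarrow>
      k \<le> card {a \<in> A. adj_dist (cycle_graph q) v a \<noteq> adj_dist (cycle_graph q) w a}"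
    using assms(2) by (auto simp: adjacency_generator_def)
  have lt: "j mod q < q" for j
    using assms(1) by simp
  show "k \<le> cycle_ind q A i + cycle_ind q A (i + 1) + cycle_ind q A (i + 2) + cycle_ind q A (i + 3)"
    unfolding card_distinguishing_cycle_1[OF assms(1) A, symmetric]
    by (intro k lt add_mod_neq assms(1)) simp_all
  show "k \<le> cycle_ind q A i + cycle_ind q A (i + 1) + cycle_ind q A (i + 3) + cycle_ind q A (i + 4)"
    unfolding card_distinguishing_cycle_2[OF assms(1) A, symmetric]
    by (intro k lt add_mod_neq assms(1)) simp_all
qed

text \<open>Windows are indexed by the vertex before the pair, so a given vertex has to be written
  as a successor.\<close>

lemma cycle_predecessor:
  fixes v q :: nat
  assumes "v < q"
  obtains i where "i < q" "v = (i + 1) mod q" "\<And>c. (v + c) mod q = (i + (1 + c)) mod q"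
proof
  define i where "i = (if v = 0 then q - 1 else v - 1)"
  show "i < q" "v = (i + 1) mod q"
    using assms by (auto simp: i_def)
  then show "(v + c) mod q = (i + (1 + c)) mod q" for c
    by (metis add.assoc mod_add_left_eq)
qed

lemma cycle_pair_cases:
  fixes v w q :: nat
  assumes "5 \<le> q" "v < q" "w < q" "v \<noteq> w"
  obtains "w = (v + 1) mod q" | "w = (v + 2) mod q" | "v = (w + 1) mod q" | "v = (w + 2) mod q"
  | d where "w = (v + d) mod q" "3 \<le> d" "d + 3 \<le> q"
proof -
  obtain d where d: "d < q" "w = (v + d) mod q"
    using rotation_surj[OF assms(3), of v] .
  have "d \<noteq> 0"
    using assms(2,4) d by (metis add_0_right mod_less)
  \<comment> \<open>Going on from \<open>w\<close> for the rest of the cycle leads back to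
    \<open>v\<close>; thus \<open>d = q - 1\<close> and \<open>d = q - 2\<close> are the close cases
    with the roles exchanged.\<close>
  have wrap: "v = (w + c) mod q" if "d + c = q" for c
    using that assms(2) unfolding d(2) by (metis add.assoc mod_add_left_eq mod_add_self2 mod_less)
  consider "d = 1" | "d = 2" | "d + 1 = q" | "d + 2 = q" | "3 \<le> d" "d + 3 \<le> q"
    using \<open>d \<noteq> 0\<close> d(1) by linarith
  then show ?thesis
    by cases (use that d(2) wrap in auto)
qed

text \<open>Converse of the window conditions: pairs at distance 1 or 2 are settled by windows, all
  others by disjoint closed neighbourhoods, and the condition on distances other than 1 by
  \<open>card_A\<close>.\<close>

lemma balanced_adjacency_generator_cycle:
  assumes q: "5 \<le> q" and A: "A \<subseteq> {..<q}" and card_A: "k + 4 \<le> 2 * card A"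
    and 1: "\<And>i. i < q \<Longrightarrow> k \<le> cycle_ind q A i + cycle_ind q A (i + 1) + cycle_ind q A (i + 2)
      + cycle_ind q A (i + 3)"
    and 2: "\<And>i. i < q \<Longrightarrow> k \<le> cycle_ind q A i + cycle_ind q A (i + 1) + cycle_ind q A (i + 3)
      + cycle_ind q A (i + 4)"
    and N: "\<And>i. i < q \<Longrightarrow> k \<le> 2 * (cycle_ind q A i + cycle_ind q A (i + 1) + cycle_ind q A (i + 2))"
  shows "balanced_adjacency_generator k (cycle_graph q) A"
proof -
  have finite_A: "finite A"
    using A finite_subset by blast
  have D1: "k \<le> card {a \<in> A. adj_dist (cycle_graph q) v a \<noteq> adj_dist (cycle_graph q) ((v + 1) mod q) a}"
    if "v < q" for v
  proof -
    obtain i where i: "i < q" "v = (i + 1) mod q" "(v + 1) mod q = (i + 2) mod q"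
      using cycle_predecessor[OF \<open>v < q\<close>] by (metis one_add_one)
    show ?thesis
      unfolding i(3) unfolding i(2) card_distinguishing_cycle_1[OF q A] by (rule 1[OF i(1)])
  qed
  have D2: "k \<le> card {a \<in> A. adj_dist (cycle_graph q) v a \<noteq> adj_dist (cycle_graph q) ((v + 2) mod q) a}"
    if "v < q" for v
  proof -
    obtain i where i: "i < q" "v = (i + 1) mod q" "(v + 2) mod q = (i + 3) mod q"
      using cycle_predecessor[OF \<open>v < q\<close>] by (metis numeral_plus_numeral one_plus_numeral semiring_norm(3))
    show ?thesis
      unfolding i(3) unfolding i(2) card_distinguishing_cycle_2[OF q A] by (rule 2[OF i(1)])
  qed
  have N': "k \<le> 2 * card {a \<in> A. adj_dist (cycle_graph q) v a \<le> 1}" if "v < q" for v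
  proof -
    obtain i where i: "i < q" "v = (i + 1) mod q"
      using cycle_predecessor[OF \<open>v < q\<close>] by metis
    show ?thesis
      unfolding i(2) card_closed_neighbourhood_cycle[OF q A] by (rule N[OF i(1)])
  qed
  have "k \<le> card {a \<in> A. adj_dist (cycle_graph q) v a \<noteq> adj_dist (cycle_graph q) w a}"
    if "v < q" "w < q" "v \<noteq> w" for v w
    using q that
  proof (cases rule: cycle_pair_cases)
    case 5
    show ?thesis
    proof (rule card_adj_dist_neq_if_far[OF finite_A N'[OF that(1)] N'[OF that(2)]])
      fix a assume "a \<in> A" "adj_dist (cycle_graph q) v a \<le> 1" "adj_dist (cycle_graph q) w a \<le> 1"
      then show False
        using far_cycle[OF that(1) 5(2,3), of a] 5(1) A by auto
    qed
  next
    case 1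
    then show ?thesis using D1[OF that(1)] by simp
  next
    case 2
    then show ?thesis using D2[OF that(1)] by simp
  next
    case 3
    then show ?thesis using D1[OF that(2)] by (simp add: eq_commute[of "adj_dist _ w _"])
  next
    case 4
    then show ?thesis using D2[OF that(2)] by (simp add: eq_commute[of "adj_dist _ w _"])
  qed
  moreover have "k \<le> 2 * card {a \<in> A. adj_dist (cycle_graph q) v a \<noteq> 1}" if "v < q" for v
  proof (rule card_adj_dist_neq_1[OF finite_A _ card_A])
    fix a assume "a \<in> A" "adj_dist (cycle_graph q) v a = 1"
    then show "a = (if v + 1 = q then 0 else v + 1) \<or> a = (if v = 0 then q - 1 else v - 1)"
      using A that q by (auto simp: adj_dist_cycle_graph subset_iff split: if_splits)
  qed
  ultimately show ?thesis
    using A N' by (simp add: balanced_adjacency_generator_def adjacency_generator_def)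
qed

section \<open>Lower bounds for cycles\<close>

lemma card_eq_sum_cycle_ind:
  assumes "A \<subseteq> {..<q}"
  shows "card A = (\<Sum>i<q. cycle_ind q A i)"
proof -
  have "(\<Sum>i<q. cycle_ind q A i) = (\<Sum>i<q. of_bool (i \<in> A))"
    by (intro sum.cong) (auto simp: cycle_ind_def)
  also have "\<dots> = card ({..<q} \<inter> A)"
    by (simp add: sum_of_bool_eq)
  also have "{..<q} \<inter> A = A"
    using assms by auto
  finally show ?thesis by simp
qed

lemma sum_cycle_ind_shift: "(\<Sum>i<q. cycle_ind q A (i + c)) = (\<Sum>i<q. cycle_ind q A i)"
proof (induction c)
  case (Suc c)
  \<comment> \<open>Shifting by one drops the term at \<open>c\<close> and adds the one at
    \<open>q + c\<close>, which are equal by periodicity.\<close>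
  have "(\<Sum>i<q. cycle_ind q A (i + Suc c)) + cycle_ind q A c = (\<Sum>i<Suc q. cycle_ind q A (i + c))"
    by (subst sum.lessThan_Suc_shift) simp
  also have "\<dots> = (\<Sum>i<q. cycle_ind q A (i + c)) + cycle_ind q A c"
    by (simp add: cycle_ind_def)
  finally show ?case using Suc by simp
qed simp

text \<open>Double counting: each vertex lies in exactly four of the \<open>q\<close>
  windows.\<close>

lemma adjacency_generator_cycle_card_ge:
  assumes "5 \<le> q" "adjacency_generator k (cycle_graph q) A"
  shows "q * k \<le> 4 * card A"
proof -
  have A: "A \<subseteq> {..<q}"
    using assms(2) by (simp add: adjacency_generator_def)
  have "q * k = (\<Sum>i<q. k)" by simp
  also have "\<dots> \<le> (\<Sum>i<q. cycle_ind q A i + cycle_ind q A (i + 1) + cycle_ind q A (i + 2)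
      + cycle_ind q A (i + 3))"
    using adjacency_generator_cycle_windows(1)[OF assms] by (intro sum_mono) simp
  also have "\<dots> = 4 * card A"
    unfolding sum.distrib sum_cycle_ind_shift card_eq_sum_cycle_ind[OF A] by simp
  finally show ?thesis .
qed

text \<open>Any two of five consecutive positions lie together in one of the three windows used, and
  a window misses at most one element. So five consecutive positions miss at most one, and each
  vertex is counted in five such blocks.\<close>

lemma adjacency_generator_3_cycle_card_ge:
  assumes "5 \<le> q" "adjacency_generator 3 (cycle_graph q) A"
  shows "4 * q \<le> 5 * card A"
proof -
  have A: "A \<subseteq> {..<q}"
    using assms(2) by (simp add: adjacency_generator_def)
  have "4 \<le> cycle_ind q A i + cycle_ind q A (i + 1) + cycle_ind q A (i + 2)
      + cycle_ind q A (i + 3) + cycle_ind q A (i + 4)" for i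
  proof -
    have "3 \<le> cycle_ind q A (i + 1) + cycle_ind q A (i + 2) + cycle_ind q A (i + 3) + cycle_ind q A (i + 4)"
      using adjacency_generator_cycle_windows(1)[OF assms, of "i + 1"]
      by (simp add: eval_nat_numeral)
    then show ?thesis
      using adjacency_generator_cycle_windows[OF assms, of i] cycle_ind_le[of q A i]
        cycle_ind_le[of q A "i + 1"] cycle_ind_le[of q A "i + 2"] cycle_ind_le[of q A "i + 3"]
        cycle_ind_le[of q A "i + 4"]
      by linarith
  qed
  then have "(\<Sum>i<q. 4) \<le> (\<Sum>i<q. cycle_ind q A i + cycle_ind q A (i + 1) + cycle_ind q A (i + 2)
      + cycle_ind q A (i + 3) + cycle_ind q A (i + 4))"
    by (intro sum_mono) simp
  also have "\<dots> = 5 * card A"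
    unfolding sum.distrib sum_cycle_ind_shift card_eq_sum_cycle_ind[OF A] by simp
  finally show ?thesis by simp
qed

section \<open>Adjacency dimensions of cycles\<close>

lemma balanced_adjacency_dim_2_cycle:
  assumes "5 \<le> q"
  shows "balanced_adjacency_dim 2 (cycle_graph q) ((q + 1) div 2)"
  unfolding balanced_adjacency_dim_def
proof (intro conjI exI allI impI)
  \<comment> \<open>Every second vertex; for odd \<open>q\<close> the neighbours
    \<open>q - 1\<close> and 0 are both chosen.\<close>
  let ?A = "{w. w < q \<and> even w}"
  show "card ?A = (q + 1) div 2"
    by (rule card_even_less)
  have ind: "cycle_ind q ?A i = of_bool (even (i mod q))" for i
    using assms by (simp add: cycle_ind_def)
  show "balanced_adjacency_generator 2 (cycle_graph q) ?A"
  proof (rule balanced_adjacency_generator_cycle[OF assms])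
    show "?A \<subseteq> {..<q}" by auto
    show "2 + 4 \<le> 2 * card ?A"
      unfolding card_even_less using assms by presburger
    fix i assume i: "i < q"
    show "2 \<le> cycle_ind q ?A i + cycle_ind q ?A (i + 1) + cycle_ind q ?A (i + 2) + cycle_ind q ?A (i + 3)"
      unfolding ind add_mod_if[OF assms i]
      using i by (rule less_cases_4; cases "even i") (use assms in simp_all)
    show "2 \<le> cycle_ind q ?A i + cycle_ind q ?A (i + 1) + cycle_ind q ?A (i + 3) + cycle_ind q ?A (i + 4)"
      unfolding ind add_mod_if[OF assms i]
      using i by (rule less_cases_4; cases "even i") (use assms in simp_all)
    show "2 \<le> 2 * (cycle_ind q ?A i + cycle_ind q ?A (i + 1) + cycle_ind q ?A (i + 2))"
      unfolding ind add_mod_if[OF assms i]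
      using i by (rule less_cases_4; cases "even i") (use assms in simp_all)
  qed
next
  fix A assume "adjacency_generator 2 (cycle_graph q) A"
  from adjacency_generator_cycle_card_ge[OF assms this] show "(q + 1) div 2 \<le> card A"
    by linarith
qed

lemma balanced_adjacency_dim_3_cycle:
  assumes "5 \<le> q"
  shows "balanced_adjacency_dim 3 (cycle_graph q) (q - q div 5)"
  unfolding balanced_adjacency_dim_def
proof (intro conjI exI allI impI)
  let ?A = "{w. w < q \<and> w mod 5 \<noteq> 4}"
  show "card ?A = q - q div 5"
    by (rule card_mod_5_neq_4_less)
  have ind: "cycle_ind q ?A i = of_bool (i mod q mod 5 \<noteq> 4)" for i
    using assms by (simp add: cycle_ind_def)
  have four: "4 \<le> cycle_ind q ?A i + cycle_ind q ?A (i + 1) + cycle_ind q ?A (i + 2)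
      + cycle_ind q ?A (i + 3) + cycle_ind q ?A (i + 4)" if "i < q" for i
  proof -
    \<comment> \<open>A position past the end wraps to one of the vertices 0 to 3, all of which are
      in \<open>?A\<close>, so wrapping around can only help.\<close>
    have le: "of_bool ((i + c) mod 5 \<noteq> 4) \<le> cycle_ind q ?A (i + c)" if "c \<le> 4" for c
    proof (cases "i + c < q")
      case False
      then have "(i + c) mod q < 4"
        using assms that \<open>i < q\<close> by (simp add: le_mod_geq)
      then show ?thesis by (simp add: ind)
    qed (simp add: ind)
    show ?thesis
      using at_most_one_residue_mod_5[of i 4] le[of 0] le[of 1] le[of 2] le[of 3] le[of 4]
      unfolding add_0_right by linarith
  qed
  show "balanced_adjacency_generator 3 (cycle_graph q) ?A"
  proof (rule balanced_adjacency_generator_cycle[OF assms])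
    show "?A \<subseteq> {..<q}" by auto
    show "3 + 4 \<le> 2 * card ?A"
      unfolding card_mod_5_neq_4_less using assms by linarith
    fix i assume "i < q"
    \<comment> \<open>With at least four hits among five positions, leaving out one position keeps
      three hits and leaving out two keeps two.\<close>
    note le = four[OF this] cycle_ind_le[of q ?A i] cycle_ind_le[of q ?A "i + 2"]
      cycle_ind_le[of q ?A "i + 3"] cycle_ind_le[of q ?A "i + 4"]
    show "3 \<le> cycle_ind q ?A i + cycle_ind q ?A (i + 1) + cycle_ind q ?A (i + 2) + cycle_ind q ?A (i + 3)"
      using le by linarith
    show "3 \<le> cycle_ind q ?A i + cycle_ind q ?A (i + 1) + cycle_ind q ?A (i + 3) + cycle_ind q ?A (i + 4)"
      using le by linarith
    have "3 \<le> 2 * x" if "2 \<le> x" for x :: nat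
      using that by linarith
    moreover have "2 \<le> cycle_ind q ?A i + cycle_ind q ?A (i + 1) + cycle_ind q ?A (i + 2)"
      using le by linarith
    ultimately show "3 \<le> 2 * (cycle_ind q ?A i + cycle_ind q ?A (i + 1) + cycle_ind q ?A (i + 2))" .
  qed
next
  fix A assume "adjacency_generator 3 (cycle_graph q) A"
  \<comment> \<open>Rounding \<open>4 * q / 5\<close> up gives \<open>q - q div 5\<close>.\<close>
  from adjacency_generator_3_cycle_card_ge[OF assms this] show "q - q div 5 \<le> card A"
    by linarith
qed

lemma balanced_adjacency_dim_4_cycle:
  assumes "5 \<le> q"
  shows "balanced_adjacency_dim 4 (cycle_graph q) q"
  unfolding balanced_adjacency_dim_def
proof (intro conjI exI allI impI)
  show "card {..<q} = q" by simp
  have "cycle_ind q {..<q} i = 1" for i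
    using assms by (simp add: cycle_ind_def)
  then show "balanced_adjacency_generator 4 (cycle_graph q) {..<q}"
    using assms by (intro balanced_adjacency_generator_cycle) simp_all
next
  fix A assume "adjacency_generator 4 (cycle_graph q) A"
  from adjacency_generator_cycle_card_ge[OF assms this] show "q \<le> card A"
    by linarith
qed

subsection \<open>Paths\<close>

text \<open>Shifted by one, so that \<open>path_ind A 0 = 0\<close> stands for the missing vertex before the path.\<close>

definition path_ind :: "nat set \<Rightarrow> nat \<Rightarrow> nat" where
  "path_ind A i = (case i of 0 \<Rightarrow> 0 | Suc j \<Rightarrow> of_bool (j \<in> A))"

lemma path_ind_0 [simp]: "path_ind A 0 = 0"
  and path_ind_Suc: "path_ind A (Suc j) = of_bool (j \<in> A)"
  by (simp_all add: path_ind_def)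

lemma path_ind_le: "path_ind A i \<le> 1"
  by (simp add: path_ind_def split: nat.split)

lemma pverts_path_graph [simp]: "pverts (path_graph q) = {..<q}"
  by (simp add: path_graph_def)

lemma adj_dist_path_graph:
  assumes "v < q" "w < q"
  shows "adj_dist (path_graph q) v w = (if v = w then 0 else if w = v + 1 \<or> v = w + 1 then 1 else 2)"
  using assms by (auto simp: adj_dist_def path_graph_def)

text \<open>By the shift, the indices \<open>i\<close> to \<open>i + 3\<close> stand for the
  vertices \<open>i - 1\<close> to \<open>i + 2\<close>. Positions beyond either end contribute 0,
  so one formula covers the whole path.\<close>

lemma card_distinguishing_path_1:
  assumes "i + 1 < q" "A \<subseteq> {..<q}"
  shows "card {a \<in> A. adj_dist (path_graph q) i a \<noteq> adj_dist (path_graph q) (i + 1) a}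
    = path_ind A i + path_ind A (i + 1) + path_ind A (i + 2) + path_ind A (i + 3)" (is "?lhs = ?rhs")
proof -
  have lt: "i < q" "i + 1 < q"
    using assms(1) by simp_all
  have iff: "adj_dist (path_graph q) i a \<noteq> adj_dist (path_graph q) (i + 1) a
      \<longleftrightarrow> a + 1 = i \<or> a = i \<or> a = i + 1 \<or> a = i + 2" if "a \<in> A" for a
  proof -
    have a: "a < q" using assms(2) that by auto
    show ?thesis
      unfolding adj_dist_path_graph[OF lt(1) a] adj_dist_path_graph[OF lt(2) a] by auto
  qed
  have "{a \<in> A. adj_dist (path_graph q) i a \<noteq> adj_dist (path_graph q) (i + 1) a}
      = {a \<in> A. a + 1 = i \<or> a = i \<or> a = i + 1 \<or> a = i + 2}"
    using iff by blast
  then have "?lhs = card {a \<in> A. a + 1 = i \<or> a = i \<or> a = i + 1 \<or> a = i + 2}"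
    by (rule arg_cong)
  also have "\<dots> = ?rhs"
  proof (cases i)
    case 0
    then show ?thesis
      by (subst card_conj_eq_sum_of_bool[of "{0, 1, 2}"]) (auto simp: path_ind_Suc eval_nat_numeral)
  next
    case (Suc j)
    then show ?thesis
      by (subst card_conj_eq_sum_of_bool[of "{j, j + 1, j + 2, j + 3}"]) (auto simp: path_ind_Suc eval_nat_numeral)
  qed
  finally show ?thesis .
qed

text \<open>The common neighbour \<open>i + 1\<close> has the shifted index \<open>i + 2\<close>,
  whose term is therefore missing.\<close>

lemma card_distinguishing_path_2:
  assumes "i + 2 < q" "A \<subseteq> {..<q}"
  shows "card {a \<in> A. adj_dist (path_graph q) i a \<noteq> adj_dist (path_graph q) (i + 2) a}
    = path_ind A i + path_ind A (i + 1) + path_ind A (i + 3) + path_ind A (i + 4)" (is "?lhs = ?rhs")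
proof -
  have lt: "i < q" "i + 2 < q"
    using assms(1) by simp_all
  have iff: "adj_dist (path_graph q) i a \<noteq> adj_dist (path_graph q) (i + 2) a
      \<longleftrightarrow> a + 1 = i \<or> a = i \<or> a = i + 2 \<or> a = i + 3" if "a \<in> A" for a
  proof -
    have a: "a < q" using assms(2) that by auto
    show ?thesis
      unfolding adj_dist_path_graph[OF lt(1) a] adj_dist_path_graph[OF lt(2) a] by auto
  qed
  have "{a \<in> A. adj_dist (path_graph q) i a \<noteq> adj_dist (path_graph q) (i + 2) a}
      = {a \<in> A. a + 1 = i \<or> a = i \<or> a = i + 2 \<or> a = i + 3}"
    using iff by blast
  then have "?lhs = card {a \<in> A. a + 1 = i \<or> a = i \<or> a = i + 2 \<or> a = i + 3}"
    by (rule arg_cong)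
  also have "\<dots> = ?rhs"
  proof (cases i)
    case 0
    then show ?thesis
      by (subst card_conj_eq_sum_of_bool[of "{0, 2, 3}"]) (auto simp: path_ind_Suc eval_nat_numeral)
  next
    case (Suc j)
    then show ?thesis
      by (subst card_conj_eq_sum_of_bool[of "{j, j + 1, j + 3, j + 4}"]) (auto simp: path_ind_Suc eval_nat_numeral)
  qed
  finally show ?thesis .
qed

lemma card_closed_neighbourhood_path:
  assumes "i < q" "A \<subseteq> {..<q}"
  shows "card {a \<in> A. adj_dist (path_graph q) i a \<le> 1}
    = path_ind A i + path_ind A (i + 1) + path_ind A (i + 2)" (is "?lhs = ?rhs")
proof -
  have iff: "adj_dist (path_graph q) i a \<le> 1 \<longleftrightarrow> a + 1 = i \<or> a = i \<or> a = i + 1" if "a \<in> A" for a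
  proof -
    have a: "a < q" using assms(2) that by auto
    show ?thesis
      unfolding adj_dist_path_graph[OF assms(1) a] by auto
  qed
  have "{a \<in> A. adj_dist (path_graph q) i a \<le> 1}
      = {a \<in> A. a + 1 = i \<or> a = i \<or> a = i + 1}"
    using iff by blast
  then have "?lhs = card {a \<in> A. a + 1 = i \<or> a = i \<or> a = i + 1}"
    by (rule arg_cong)
  also have "\<dots> = ?rhs"
  proof (cases i)
    case 0
    then show ?thesis
      by (subst card_conj_eq_sum_of_bool[of "{0, 1}"]) (auto simp: path_ind_Suc eval_nat_numeral)
  next
    case (Suc j)
    then show ?thesis
      by (subst card_conj_eq_sum_of_bool[of "{j, j + 1, j + 2}"]) (auto simp: path_ind_Suc eval_nat_numeral)
  qed
  finally show ?thesis .
qed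

lemma adjacency_generator_path_windows:
  assumes "adjacency_generator k (path_graph q) A"
  shows "i + 1 < q \<Longrightarrow> k \<le> path_ind A i + path_ind A (i + 1) + path_ind A (i + 2) + path_ind A (i + 3)"
    and "i + 2 < q \<Longrightarrow> k \<le> path_ind A i + path_ind A (i + 1) + path_ind A (i + 3) + path_ind A (i + 4)"
proof -
  have A: "A \<subseteq> {..<q}"
    and k: "\<And>v w. v < q \<Longrightarrow> w < q \<Longrightarrow> v \<noteq> w \<Longrightarrow>
      k \<le> card {a \<in> A. adj_dist (path_graph q) v a \<noteq> adj_dist (path_graph q) w a}"
    using assms by (auto simp: adjacency_generator_def)
  show "k \<le> path_ind A i + path_ind A (i + 1) + path_ind A (i + 2) + path_ind A (i + 3)" if "i + 1 < q"
    unfolding card_distinguishing_path_1[OF that A, symmetric] using that by (intro k) simp_all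
  show "k \<le> path_ind A i + path_ind A (i + 1) + path_ind A (i + 3) + path_ind A (i + 4)" if "i + 2 < q"
    unfolding card_distinguishing_path_2[OF that A, symmetric] using that by (intro k) simp_all
qed

text \<open>Converse of the window conditions, as for cycles; vertices at distance 3 or more have
  disjoint closed neighbourhoods.\<close>

lemma balanced_adjacency_generator_path:
  assumes A: "A \<subseteq> {..<q}" and card_A: "k + 4 \<le> 2 * card A"
    and 1: "\<And>i. i + 1 < q \<Longrightarrow> k \<le> path_ind A i + path_ind A (i + 1) + path_ind A (i + 2)
      + path_ind A (i + 3)"
    and 2: "\<And>i. i + 2 < q \<Longrightarrow> k \<le> path_ind A i + path_ind A (i + 1) + path_ind A (i + 3)
      + path_ind A (i + 4)"
    and N: "\<And>i. i < q \<Longrightarrow> k \<le> 2 * (path_ind A i + path_ind A (i + 1) + path_ind A (i + 2))"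
  shows "balanced_adjacency_generator k (path_graph q) A"
proof -
  have finite_A: "finite A"
    using A finite_subset by blast
  have N': "k \<le> 2 * card {a \<in> A. adj_dist (path_graph q) v a \<le> 1}" if "v < q" for v
    unfolding card_closed_neighbourhood_path[OF that A] by (rule N[OF that])
  have less: "k \<le> card {a \<in> A. adj_dist (path_graph q) v a \<noteq> adj_dist (path_graph q) w a}"
    if "v < w" "w < q" for v w
  proof -
    have v: "v < q" using that by simp
    consider "w = v + 1" | "w = v + 2" | "v + 3 \<le> w"
      using \<open>v < w\<close> by linarith
    then show ?thesis
    proof cases
      case 1
      then show ?thesis
        using assms(3)[of v] card_distinguishing_path_1[of v q A] A that by simp
    next
      case 2
      then show ?thesis
        using assms(4)[of v] card_distinguishing_path_2[of v q A] A that by simp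
    next
      case 3
      show ?thesis
      proof (rule card_adj_dist_neq_if_far[OF finite_A N'[OF v] N'[OF that(2)]])
        fix a assume a: "a \<in> A" "adj_dist (path_graph q) v a \<le> 1" "adj_dist (path_graph q) w a \<le> 1"
        then have "a < q" using A by auto
        with a show False
          using 3 v that(2) by (auto simp: adj_dist_path_graph split: if_splits)
      qed
    qed
  qed
  have "k \<le> card {a \<in> A. adj_dist (path_graph q) v a \<noteq> adj_dist (path_graph q) w a}"
    if "v < q" "w < q" "v \<noteq> w" for v w
  proof (cases "v < w")
    case True
    then show ?thesis using less that(2) by simp
  next
    case False
    then show ?thesis using less[of w v] that by (simp add: eq_commute[of "adj_dist _ v _"])
  qed
  moreover have "k \<le> 2 * card {a \<in> A. adj_dist (path_graph q) v a \<noteq> 1}" if "v < q" for v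
  proof (rule card_adj_dist_neq_1[OF finite_A _ card_A])
    fix a assume a: "a \<in> A" "adj_dist (path_graph q) v a = 1"
    then have "a < q" using A by auto
    with a show "a = v + 1 \<or> a = v - 1"
      using that by (auto simp: adj_dist_path_graph split: if_splits)
  qed
  ultimately show ?thesis
    using A N' by (simp add: balanced_adjacency_generator_def adjacency_generator_def)
qed

section \<open>Lower bounds for paths\<close>

text \<open>The last vertex \<open>q - 1\<close> has the shifted index \<open>q\<close>, hence the
  condition \<open>q < m\<close>.\<close>

lemma sum_path_ind:
  assumes "A \<subseteq> {..<q}" "q < m"
  shows "(\<Sum>i<m. path_ind A i) = card A"
proof -
  have "(\<Sum>i<m. path_ind A i) = (\<Sum>i<m - 1. of_bool (i \<in> A))"
    using assms(2) by (cases m) (simp_all add: sum.lessThan_Suc_shift path_ind_Suc del: sum.lessThan_Suc)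
  also have "\<dots> = card ({..<m - 1} \<inter> A)"
    by (simp add: sum_of_bool_eq)
  also have "{..<m - 1} \<inter> A = A"
    using assms by auto
  finally show ?thesis .
qed

lemma path_ind_eq_0: "A \<subseteq> {..<q} \<Longrightarrow> q < i \<Longrightarrow> path_ind A i = 0"
  by (cases i) (auto simp: path_ind_Suc)

text \<open>Double counting on a line: inner positions lie in four windows, and the extra terms make
  up for the three positions at either end that lie in fewer.\<close>

lemma sum_windows_4:
  fixes s :: "nat \<Rightarrow> nat"
  shows "(\<Sum>i<m. s i + s (i + 1) + s (i + 2) + s (i + 3)) + 3 * s 0 + 2 * s 1 + s 2
    + s m + 2 * s (m + 1) + 3 * s (m + 2) = 4 * (\<Sum>i<m + 3. s i)"
  by (induction m) (simp_all add: eval_nat_numeral)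

lemma sum_windows_5:
  fixes s :: "nat \<Rightarrow> nat"
  shows "(\<Sum>i<m. s i + s (i + 1) + s (i + 2) + s (i + 3) + s (i + 4)) + 4 * s 0 + 3 * s 1 + 2 * s 2 + s 3
    + s m + 2 * s (m + 1) + 3 * s (m + 2) + 4 * s (m + 3) = 5 * (\<Sum>i<m + 4. s i)"
  by (induction m) (simp_all add: eval_nat_numeral)

lemma adjacency_generator_2_path_card_ge:
  assumes "4 \<le> q" "adjacency_generator 2 (path_graph q) A"
  shows "q + 1 \<le> 2 * card A"
proof -
  have A: "A \<subseteq> {..<q}"
    using assms(2) by (simp add: adjacency_generator_def)
  define m where "m = q - 2"
  have q: "q = m + 2"
    using assms(1) by (simp add: m_def)
  let ?s = "path_ind A"
  define W where "W i = ?s i + ?s (i + 1) + ?s (i + 2) + ?s (i + 3)" for i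
  have W: "2 \<le> W i" if "i < m + 1" for i
    using adjacency_generator_path_windows(1)[OF assms(2), of i] that by (simp add: W_def q)
  \<comment> \<open>\<open>W 1\<close> is kept apart, since its contribution beyond 2 is needed for
    the estimate at the left end.\<close>
  have "W 1 + m * 2 \<le> (\<Sum>i<m + 1. W i)"
  proof -
    have "(\<Sum>i\<in>{..<m + 1} - {1}. 2) \<le> (\<Sum>i\<in>{..<m + 1} - {1}. W i)"
      using W by (intro sum_mono) simp
    then show ?thesis
      using assms(1) sum.remove[of "{..<m + 1}" 1 W] by (simp add: q)
  qed
  moreover have "(\<Sum>i<m + 1. W i) + 2 * ?s 1 + ?s 2 + ?s (m + 1) + 2 * ?s (m + 2) = 4 * card A"
    using sum_windows_4[of ?s "m + 1"] sum_path_ind[OF A, of "m + 4"] path_ind_eq_0[OF A, of "m + 3"]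
    by (simp add: W_def q add.assoc eval_nat_numeral del: sum.lessThan_Suc)
  \<comment> \<open>If \<open>?s 1 = 1\<close>, this is \<open>W 1\<close> at least 2 plus the
    correction. If \<open>?s 1 = 0\<close>, the two windows at the left end force
    \<open>?s 2\<close>, \<open>?s 3\<close> and \<open>?s 4\<close> to be 1.\<close>
  moreover have "4 \<le> W 1 + 2 * ?s 1 + ?s 2"
  proof -
    have "2 \<le> ?s 1 + ?s 2 + ?s 3" "2 \<le> ?s 1 + ?s 3 + ?s 4"
      using adjacency_generator_path_windows[OF assms(2), of 0, unfolded add_0 path_ind_0] assms(1)
      by linarith+
    moreover have "W 1 = ?s 1 + ?s 2 + ?s 3 + ?s 4"
      by (simp add: W_def eval_nat_numeral)
    ultimately show ?thesis
      using path_ind_le[of A 1] path_ind_le[of A 2] path_ind_le[of A 3] path_ind_le[of A 4]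
      by linarith
  qed
  \<comment> \<open>The last window loses its fourth position, so two of its remaining three are in
    \<open>A\<close>.\<close>
  moreover have "1 \<le> ?s (m + 1) + 2 * ?s (m + 2)"
    using W[of m] path_ind_eq_0[OF A, of "m + 3"] path_ind_le[of A m] by (simp add: W_def q)
  ultimately have "m * 2 + 5 \<le> 4 * card A"
    by linarith
  \<comment> \<open>The bound reads \<open>2 * q + 1 \<le> 4 * card A\<close>; integrality of
    \<open>card A\<close> gives the rest.\<close>
  then show ?thesis
    using q by linarith
qed

text \<open>The \<open>q - 2\<close> blocks of five hold at least four elements each, as for cycles.
  The first and last windows are cut to three positions and must be full, so the corrections are
  \<open>3 + 2 + 1\<close> at each end.\<close>

lemma adjacency_generator_3_path_card_ge:
  assumes "4 \<le> q" "adjacency_generator 3 (path_graph q) A"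
  shows "4 * q + 4 \<le> 5 * card A"
proof -
  have A: "A \<subseteq> {..<q}"
    using assms(2) by (simp add: adjacency_generator_def)
  define m where "m = q - 2"
  have q: "q = m + 2"
    using assms(1) by (simp add: m_def)
  let ?s = "path_ind A"
  have 1: "3 \<le> ?s i + ?s (i + 1) + ?s (i + 2) + ?s (i + 3)" if "i < m + 1" for i
    using adjacency_generator_path_windows(1)[OF assms(2), of i] that by (simp add: q)
  have 2: "3 \<le> ?s i + ?s (i + 1) + ?s (i + 3) + ?s (i + 4)" if "i < m" for i
    using adjacency_generator_path_windows(2)[OF assms(2), of i] that by (simp add: q)
  note le = path_ind_le[of A]
  have "4 \<le> ?s i + ?s (i + 1) + ?s (i + 2) + ?s (i + 3) + ?s (i + 4)" if "i < m" for i
  proof -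
    have "3 \<le> ?s (i + 1) + ?s (i + 2) + ?s (i + 3) + ?s (i + 4)"
      using 1[of "i + 1"] that by (simp add: eval_nat_numeral)
    then show ?thesis
      using 1[of i] 2[OF that] that le[of i] le[of "i + 1"] le[of "i + 2"] le[of "i + 3"] le[of "i + 4"]
      by linarith
  qed
  then have "(\<Sum>i<m. 4) \<le> (\<Sum>i<m. ?s i + ?s (i + 1) + ?s (i + 2) + ?s (i + 3) + ?s (i + 4))"
    by (intro sum_mono) simp
  moreover have "?s 1 = 1" "?s 2 = 1" "?s 3 = 1"
    using 1[of 0, unfolded add_0] le[of 1] le[of 2] le[of 3] path_ind_0[of A] by linarith+
  moreover have "?s m = 1" "?s (m + 1) = 1" "?s (m + 2) = 1"
    using 1[of m] le[of m] le[of "m + 1"] le[of "m + 2"] path_ind_eq_0[OF A, of "m + 3", unfolded q]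
    by linarith+
  ultimately show ?thesis
    using sum_windows_5[of ?s m] sum_path_ind[OF A, of "m + 4"] by (simp add: q)
qed

section \<open>Adjacency dimensions of paths\<close>

lemma balanced_adjacency_dim_2_path:
  assumes "4 \<le> q"
  shows "balanced_adjacency_dim 2 (path_graph q) (q div 2 + 1)"
proof -
  \<comment> \<open>Every second vertex from 0 on, and the last vertex in any case: for even
    \<open>q\<close> the window cut off at the right end would otherwise contain just one
    element.\<close>
  define A where "A = insert (q - 1) {w. w < q - 1 \<and> even w}"
  have card: "card A = q div 2 + 1"
    using assms by (simp add: A_def card_even_less)
  have ind: "path_ind A i = of_bool (i = q \<or> i < q \<and> odd i)" for i
    using assms by (cases i) (auto simp: A_def path_ind_Suc)
  have "balanced_adjacency_generator 2 (path_graph q) A"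
  proof (rule balanced_adjacency_generator_path)
    show "A \<subseteq> {..<q}"
      using assms by (auto simp: A_def)
    show "2 + 4 \<le> 2 * card A"
      unfolding card using assms by presburger
    show "2 \<le> path_ind A i + path_ind A (i + 1) + path_ind A (i + 2) + path_ind A (i + 3)"
      if "i + 1 < q" for i
      using that by (cases "even i") (auto simp: ind)
    show "2 \<le> path_ind A i + path_ind A (i + 1) + path_ind A (i + 3) + path_ind A (i + 4)"
      if "i + 2 < q" for i
      using that by (cases "even i") (auto simp: ind)
    show "2 \<le> 2 * (path_ind A i + path_ind A (i + 1) + path_ind A (i + 2))" if "i < q" for i
      using that by (cases "even i") (auto simp: ind)
  qed
  moreover have "q div 2 + 1 \<le> card B" if "adjacency_generator 2 (path_graph q) B" for B
    using adjacency_generator_2_path_card_ge[OF assms that] by linarith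
  ultimately show ?thesis
    using card by (auto simp: balanced_adjacency_dim_def)
qed

lemma balanced_adjacency_dim_3_path:
  assumes "4 \<le> q"
  shows "balanced_adjacency_dim 3 (path_graph q) (q - (q - 4) div 5)"
proof -
  \<comment> \<open>Every fifth vertex is left out, except among the last four, as the windows cut
    off there have to be full.\<close>
  define A where "A = {w. w < q - 4 \<and> w mod 5 \<noteq> 4} \<union> {q - 4..<q}"
  have A: "A \<subseteq> {..<q}"
    using assms by (auto simp: A_def)
  have "card A = card {w. w < q - 4 \<and> w mod 5 \<noteq> 4} + card {q - 4..<q}"
    unfolding A_def by (intro card_Un_disjoint) auto
  then have card: "card A = q - (q - 4) div 5"
    using assms unfolding card_mod_5_neq_4_less by simp
  \<comment> \<open>The shift turns residue 4 into residue 0. The missing vertex at index 0 thus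
    fits the pattern of omissions, and the left end needs no special treatment.\<close>
  have ind: "path_ind A i = of_bool (0 < i \<and> i \<le> q \<and> (i mod 5 \<noteq> 0 \<or> q < i + 4))" for i
    using assms by (cases i) (auto simp: A_def path_ind_Suc mod_Suc)
  have tail: "path_ind A i = 1" if "q \<le> i + 3" "i \<le> q" for i
    using that assms by (simp add: ind)
  have residue: "of_bool (i mod 5 \<noteq> 0) \<le> path_ind A i" if "i \<le> q" for i
    using that by (cases "i = 0") (simp_all add: ind)
  have four: "4 \<le> path_ind A i + path_ind A (i + 1) + path_ind A (i + 2) + path_ind A (i + 3)
      + path_ind A (i + 4)" if "i + 3 \<le> q" for i
  proof (cases "i + 4 \<le> q")
    case True
    then show ?thesis
      using at_most_one_residue_mod_5[of i 0] residue[of i] residue[of "i + 1"] residue[of "i + 2"]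
        residue[of "i + 3"] residue[of "i + 4"] by linarith
  next
    case False
    then show ?thesis
      using that tail[of i] tail[of "i + 1"] tail[of "i + 2"] tail[of "i + 3"] by linarith
  qed
  have "balanced_adjacency_generator 3 (path_graph q) A"
  proof (rule balanced_adjacency_generator_path[OF A])
    show "3 + 4 \<le> 2 * card A"
      unfolding card using assms by linarith
    fix i
    note le = path_ind_le[of A i] path_ind_le[of A "i + 2"] path_ind_le[of A "i + 3"]
      path_ind_le[of A "i + 4"]
    show "3 \<le> path_ind A i + path_ind A (i + 1) + path_ind A (i + 2) + path_ind A (i + 3)"
      if "i + 1 < q"
    proof (cases "i + 3 \<le> q")
      case True
      then show ?thesis using four[of i] le by linarith
    next
      \<comment> \<open>Here \<open>i = q - 2\<close>: the window is cut to three positions, all in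
        the tail.\<close>
      case False
      then show ?thesis using that tail[of i] tail[of "i + 1"] tail[of "i + 2"] by linarith
    qed
    show "3 \<le> path_ind A i + path_ind A (i + 1) + path_ind A (i + 3) + path_ind A (i + 4)"
      if "i + 2 < q"
      using that four[of i] le by linarith
    have two: "3 \<le> 2 * x" if "2 \<le> x" for x :: nat
      using that by linarith
    show "3 \<le> 2 * (path_ind A i + path_ind A (i + 1) + path_ind A (i + 2))" if "i < q"
    proof (cases "i + 3 \<le> q")
      case True
      then show ?thesis using four[of i] le by (intro two) linarith
    next
      case False
      then show ?thesis using that tail[of i] tail[of "i + 1"] by (intro two) linarith
    qed
  qed
  moreover have "q - (q - 4) div 5 \<le> card B" if "adjacency_generator 3 (path_graph q) B" for B
    \<comment> \<open>Rounding \<open>(4 * q + 4) / 5\<close> up gives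
      \<open>q - (q - 4) div 5\<close>.\<close>
    using adjacency_generator_3_path_card_ge[OF assms that] assms by linarith
  ultimately show ?thesis
    using card by (auto simp: balanced_adjacency_dim_def)
qed

section \<open>Summing over the factors\<close>

lemma ceiling_half: "\<lceil>real m / 2\<rceil> = int ((m + 1) div 2)"
  by (cases "even m") (auto elim!: evenE oddE intro!: ceiling_unique)

lemma floor_fifth: "\<lfloor>real m / 5\<rfloor> = int (m div 5)"
  using floor_divide_of_nat_eq[of m 5] by simp

theorem theorem17:
  fixes G :: "'a pair_pre_digraph"
    and n r :: nat
    and u :: "nat \<Rightarrow> 'a"
    and q :: "nat \<Rightarrow> nat"
    and H :: "nat \<Rightarrow> nat pair_pre_digraph"
  assumes "pair_graph G"
    and "connected (with_proj G)"
    and "n \<ge> 2"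
    and "card (pverts G) = n"
    and "bij_betw u {1..n} (pverts G)"
  shows "(r \<le> n \<and>
      (\<forall>i\<in>{1..r}. q i \<ge> 4 \<and> H i = path_graph (q i)) \<and>
      (\<forall>i\<in>{r+1..n}. q i \<ge> 5 \<and> H i = cycle_graph (q i)) \<longrightarrow>
        int (metric_dim 2 (lex_product G n u H)) =
          (\<Sum>i=1..r. \<lceil>(real (q i) + 1) / 2\<rceil>) + (\<Sum>i=r+1..n. \<lceil>real (q i) / 2\<rceil>) \<and>
        int (metric_dim 3 (lex_product G n u H)) =
          (\<Sum>i=1..r. int (q i) - \<lfloor>(real (q i) - 4) / 5\<rfloor>) +
          (\<Sum>i=r+1..n. int (q i) - \<lfloor>real (q i) / 5\<rfloor>)) \<and>
    ((\<forall>i\<in>{1..n}. q i \<ge> 5 \<and> H i = cycle_graph (q i)) \<longrightarrow>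
        metric_dim 4 (lex_product G n u H) = (\<Sum>i=1..n. q i))"
proof -
  have factors: "lex_factors G n u H"
    if "\<And>i. i \<in> {1..n} \<Longrightarrow> 4 \<le> q i \<and> (H i = path_graph (q i) \<or> H i = cycle_graph (q i))"
  proof (rule lex_factors.intro)
    fix i assume "i \<in> {1..n}"
    then have "pverts (H i) = {..<q i}" "4 \<le> q i"
      using that by force+
    then show "finite (pverts (H i))" "pverts (H i) \<noteq> {}"
      by (simp_all add: lessThan_empty_iff)
  qed (use assms in simp_all)
  \<comment> \<open>Stated for any \<open>k\<close> and any closed forms \<open>P\<close> and
    \<open>C\<close> of the two adjacency dimensions, so that it serves both \<open>k = 2\<close>
    and \<open>k = 3\<close>.\<close>
  have mixed: "int (metric_dim k (lex_product G n u H))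
      = (\<Sum>i=1..r. int (P (q i))) + (\<Sum>i=r+1..n. int (C (q i)))"
    if r: "r \<le> n" and paths: "\<forall>i\<in>{1..r}. 4 \<le> q i \<and> H i = path_graph (q i)"
      and cycles: "\<forall>i\<in>{r+1..n}. 5 \<le> q i \<and> H i = cycle_graph (q i)"
      and P: "\<And>m. 4 \<le> m \<Longrightarrow> balanced_adjacency_dim k (path_graph m) (P m)"
      and C: "\<And>m. 5 \<le> m \<Longrightarrow> balanced_adjacency_dim k (cycle_graph m) (C m)"
    for k and P C :: "nat \<Rightarrow> nat"
  proof -
    define d where "d i = (if i \<le> r then P (q i) else C (q i))" for i
    have split: "i \<in> {1..r} \<or> i \<in> {r+1..n}" if "i \<in> {1..n}" for i
      using that by auto
    interpret lex_factors G n u H "{1..n}"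
    proof (rule factors)
      fix i assume "i \<in> {1..n}"
      from split[OF this] show "4 \<le> q i \<and> (H i = path_graph (q i) \<or> H i = cycle_graph (q i))"
        using paths cycles by fastforce
    qed
    have "metric_dim k (lex_product G n u H) = (\<Sum>i=1..n. d i)"
    proof (rule metric_dim_eq_sum)
      fix i assume "i \<in> {1..n}"
      from split[OF this] show "balanced_adjacency_dim k (H i) (d i)"
        using paths cycles P C by (auto simp: d_def)
    qed
    also have "{1..n} = {1..r} \<union> {r+1..n}"
      using r by auto
    also have "sum d \<dots> = sum d {1..r} + sum d {r+1..n}"
      by (rule sum.union_disjoint) auto
    also have "sum d {1..r} = (\<Sum>i=1..r. P (q i))"
      by (rule sum.cong) (auto simp: d_def)
    also have "sum d {r+1..n} = (\<Sum>i=r+1..n. C (q i))"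
      by (rule sum.cong) (auto simp: d_def)
    finally show ?thesis by simp
  qed
  have 2: "int (metric_dim 2 (lex_product G n u H)) =
          (\<Sum>i=1..r. \<lceil>(real (q i) + 1) / 2\<rceil>) + (\<Sum>i=r+1..n. \<lceil>real (q i) / 2\<rceil>)"
    if "r \<le> n" "\<forall>i\<in>{1..r}. 4 \<le> q i \<and> H i = path_graph (q i)"
      "\<forall>i\<in>{r+1..n}. 5 \<le> q i \<and> H i = cycle_graph (q i)"
  proof -
    have ceiling_P: "\<lceil>(real (q i) + 1) / 2\<rceil> = int (q i div 2 + 1)" for i
      using ceiling_half[of "q i + 1"] by (simp add: add.commute)
    show ?thesis
      unfolding ceiling_P ceiling_half
      by (rule mixed[OF that balanced_adjacency_dim_2_path balanced_adjacency_dim_2_cycle])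
  qed
  have 3: "int (metric_dim 3 (lex_product G n u H)) =
          (\<Sum>i=1..r. int (q i) - \<lfloor>(real (q i) - 4) / 5\<rfloor>) +
          (\<Sum>i=r+1..n. int (q i) - \<lfloor>real (q i) / 5\<rfloor>)"
    if prem: "r \<le> n" "\<forall>i\<in>{1..r}. 4 \<le> q i \<and> H i = path_graph (q i)"
      "\<forall>i\<in>{r+1..n}. 5 \<le> q i \<and> H i = cycle_graph (q i)"
  proof -
    \<comment> \<open>Restricted to the path indices, where \<open>4 \<le> q i\<close> makes the
      natural subtraction agree with the real one.\<close>
    have P: "int (q i) - \<lfloor>(real (q i) - 4) / 5\<rfloor> = int (q i - (q i - 4) div 5)" if "i \<in> {1..r}" for i
    proof -
      have "4 \<le> q i" using that prem(2) by blast
      moreover have "(q i - 4) div 5 \<le> q i" by simp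
      ultimately show ?thesis
        using floor_fifth[of "q i - 4"] by (simp add: of_nat_diff)
    qed
    have C: "int (q i) - \<lfloor>real (q i) / 5\<rfloor> = int (q i - q i div 5)" for i
      by (simp add: floor_fifth of_nat_diff)
    have "(\<Sum>i=1..r. int (q i) - \<lfloor>(real (q i) - 4) / 5\<rfloor>) = (\<Sum>i=1..r. int (q i - (q i - 4) div 5))"
      by (rule sum.cong[OF refl P])
    then show ?thesis
      unfolding C
      using mixed[OF prem balanced_adjacency_dim_3_path balanced_adjacency_dim_3_cycle] by simp
  qed
  have 4: "metric_dim 4 (lex_product G n u H) = (\<Sum>i=1..n. q i)"
    if cycles: "\<forall>i\<in>{1..n}. 5 \<le> q i \<and> H i = cycle_graph (q i)"
  proof -
    interpret lex_factors G n u H "{1..n}"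
      by (rule factors) (use cycles in fastforce)
    show ?thesis
      using cycles balanced_adjacency_dim_4_cycle by (intro metric_dim_eq_sum) force
  qed
  show ?thesis
    using 2 3 4 by blast
qed

end
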